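(* Let $\lambda^a$, $\lambda^{ak}$ and the CPS translation $\psi$, $(D:k)$ be as in the context, and let $k$ be a fresh variable. Then: (1) If $\Gamma\vdash^a D:A$, then $\psi(\Gamma),k:K(A)\vdash^a (D:k):R$. (2) If $\Gamma\vdash^a D:A$ and $D\to D'$ in $\lambda^a$, then $(D:k)\to^+(D':k)$ in $\lambda^{ak}$ (one or more reduction steps).
   Context: All terms are considered up to $\alpha$-renaming; $[z/y]D$ is capture-avoiding substitution. Calculus $\lambda^a$: values $V::=*\mid\lambda y_1\ldots y_n.D$ ($n\ge1$); declarations $D::=\mathsf{let}\ x_1=V_1\ \mathsf{in}\cdots\mathsf{let}\ x_m=V_m\ \mathsf{in}\ M$ ($m\ge0$); terms $M::=x\mid @(M,M_1,\ldots,M_n)$ ($n\ge1$). Convention: if $D_i=\mathsf{let}\,(x=V)^*_i\ \mathsf{in}\ M_i$, then $@(D_0,\ldots,D_n)$ abbreviates the declaration obtained by putting all these let-prefixes (renamed apart) in front of $@(M_0,\ldots,M_n)$. Evaluation contexts $E::=\mathsf{let}\ x=V\ \mathsf{in}\ [\,]\mid E[@(x_1,\ldots,x_k,[\,],M_1,\ldots,M_l)]$ ($k,l\ge0$); writing $E=\mathsf{let}\,(x'=V')^*\ \mathsf{in}\ E'$ with $E'$ not starting with a let, $E[\mathsf{let}\,(x=V)^*\ \mathsf{in}\ M]$ denotes $\mathsf{let}\,(x=V)^*\ \mathsf{in}\ \mathsf{let}\,(x'=V')^*\ \mathsf{in}\ E'[M]$ (no capture). Structural congruence $\equiv$: least equivalence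 closed under $\alpha$-renaming and the syntactic operators with $\mathsf{let}\,x_1=V_1\,\mathsf{in}\,\mathsf{let}\,x_2=V_2\,\mathsf{in}\,D\equiv\mathsf{let}\,x_2=V_2\,\mathsf{in}\,\mathsf{let}\,x_1=V_1\,\mathsf{in}\,D$ if $x_1\notin FV(V_2)$, $x_2\notin FV(V_1)$, and $\mathsf{let}\,x=V\,\mathsf{in}\,D\equiv D$ if $x\notin FV(D)$. Reduction: least relation containing $E[\mathsf{let}\,x=\lambda y_1\ldots y_n.D\ \mathsf{in}\ E'[@(x,z_1,\ldots,z_n)]]\to E[\mathsf{let}\,x=\lambda y_1\ldots y_n.D\ \mathsf{in}\ E'[[z_1/y_1,\ldots,z_n/y_n]D]]$ ($z_i$ variables) and closed under $\equiv$ on both sides. Types $A::=\langle 1\rangle\mid\langle A_1\to\cdots\to A_n\to A\rangle$ ($n\ge1$), possibly also involving a fixed distinguished result type $R$. Typing ($\Gamma$ a finite map from variables to types): $\Gamma\vdash^a x:A$ if $x:A\in\Gamma$; $\Gamma\vdash^a\mathsf{let}\,x=*\,\mathsf{in}\,D:A$ if $\Gamma,x:\langle1\rangle\vdash^a D:A$; $\Gamma\vdash^a\mathsf{let}\,x=\lambda y_1\ldots y_n.D'\,\mathsf{in}\,D:B$ if $\Gamma,y_1:A_1,\ldots,y_n:A_n\vdash^a D':C$ and $\Gamma,x:\langle A_1\to\cdots\to A_n\to C\rangle\vdash^a D:B$; $\Gamma\vdash^a @(M,N_1,\ldots,N_n):B$ if $\Gamma\vdash^a M:\langle A_1\to\cdots\to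 A_n\to B\rangle$ and $\Gamma\vdash^a N_i:A_i$ for all $i$. Sub-calculus $\lambda^{ak}$ (administrative CPS form): same reduction, structural congruence and typing rules as $\lambda^a$, restricted to values $V::=*\mid\lambda y^+.D$, declarations $D::=\mathsf{let}\,(x=V)^*\,\mathsf{in}\,M$, terms $M::=@(x,y_1,\ldots,y_n)$ (all variables, $n\ge1$), evaluation contexts $E::=\mathsf{let}\,x=V\,\mathsf{in}\,[\,]$, and types $A::=\langle1\rangle\mid\langle A_1\to\cdots\to A_n\to R\rangle$ where $R$ is a fixed result type. CPS translation: on types $\psi(\langle1\rangle)=\langle1\rangle$, $\psi(\langle A_1\to\cdots\to A_n\to B\rangle)=\langle\psi(A_1)\to\cdots\to\psi(A_n)\to K(B)\to R\rangle$ with $K(B)=\langle\psi(B)\to R\rangle$; $\psi(\Gamma)$ applies $\psi$ pointwise. On values $\psi( * )=*$, $\psi(\lambda y^+.D)=\lambda y^+\,k.(D:k)$. On declarations, for a variable $k$: $(\mathsf{let}\,x=V\,\mathsf{in}\,M):k=\mathsf{let}\,x=\psi(V)\,\mathsf{in}\,(M:k)$ (iterated over let-sequences); $@(x^*,@(M,M^+),N^* ):k=\mathsf{let}\,k'=\lambda y.(@(x^*,y,N^* ):k)\,\mathsf{in}\,(@(M,M^+):k')$ where $x^*$ is a possibly empty list of variables (including the head position) and $k',y$ are fresh; $@(x,x_1,\ldots,x_n):k=@(x,x_1,\ldots,x_n,k)$; $x:k=@(k,x)$.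
   Formalization: Evaluation contexts may carry any nonempty sequence of lets (not just one), and E[let (x=V)* in M] is read as let (x'=V')* in let (x=V)* in E'[M], context lets outermost; with the order as written, lets can leave the scope of their variables and (2) fails. *)

theory Defs
  imports Main
begin

type_synonym var = nat

datatype tm = Var var | App tm "tm list"    (* App M [N1..Nn] is @(M,N1,...,Nn) *)

datatype val = Star | Lam "var list" decl
     and decl = Let var val decl | Tm tm

datatype ty = Unit | Arr "ty list" ty | Res   (* Arr [A1..An] B = <A1 -> ... -> An -> B>; Res = R *)

primrec fv_tm :: "tm \<Rightarrow> var set" where
  "fv_tm (Var x) = {x}"
| "fv_tm (App M Ns) = fv_tm M \<union> \<Union> (set (map fv_tm Ns))"

primrec fv_val :: "val \<Rightarrow> var set" and fv_decl :: "decl \<Rightarrow> var set" where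
  "fv_val Star = {}"
| "fv_val (Lam ys D) = fv_decl D - set ys"
| "fv_decl (Let x V D) = fv_val V \<union> (fv_decl D - {x})"
| "fv_decl (Tm M) = fv_tm M"

primrec av_val :: "val \<Rightarrow> var set" and av_decl :: "decl \<Rightarrow> var set" where
  "av_val Star = {}"
| "av_val (Lam ys D) = set ys \<union> av_decl D"
| "av_decl (Let x V D) = insert x (av_val V \<union> av_decl D)"
| "av_decl (Tm M) = fv_tm M"

primrec bnd_val :: "val \<Rightarrow> var list" and bnd_decl :: "decl \<Rightarrow> var list" where
  "bnd_val Star = []"
| "bnd_val (Lam ys D) = ys @ bnd_decl D"
| "bnd_decl (Let x V D) = bnd_val V @ x # bnd_decl D"
| "bnd_decl (Tm M) = []"

definition barendregt :: "decl \<Rightarrow> bool" where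
  "barendregt D \<longleftrightarrow> distinct (bnd_decl D) \<and> set (bnd_decl D) \<inter> fv_decl D = {}"

definition fresh :: "var set \<Rightarrow> var" where
  "fresh S = Suc (Max (insert 0 S))"

section \<open>Well-formedness: lambda^a (ak = False) and lambda^ak (ak = True)\<close>

primrec wf_tm :: "tm \<Rightarrow> bool" where
  "wf_tm (Var x) = True"
| "wf_tm (App M Ns) = (Ns \<noteq> [] \<and> wf_tm M \<and> list_all id (map wf_tm Ns))"

definition flat_tm :: "tm \<Rightarrow> bool" where
  "flat_tm M \<longleftrightarrow> (\<exists>x ys. ys \<noteq> [] \<and> M = App (Var x) (map Var ys))"

primrec wf_val :: "bool \<Rightarrow> val \<Rightarrow> bool" and wf_decl :: "bool \<Rightarrow> decl \<Rightarrow> bool" where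
  "wf_val ak Star = True"
| "wf_val ak (Lam ys D) = (ys \<noteq> [] \<and> distinct ys \<and> wf_decl ak D)"
| "wf_decl ak (Let x V D) = (wf_val ak V \<and> wf_decl ak D)"
| "wf_decl ak (Tm M) = (if ak then flat_tm M else wf_tm M)"

primrec wf_ty :: "ty \<Rightarrow> bool" where
  "wf_ty Unit = True"
| "wf_ty Res = True"
| "wf_ty (Arr As B) = (As \<noteq> [] \<and> list_all id (map wf_ty As) \<and> wf_ty B)"

primrec subst_tm :: "(var \<Rightarrow> var) \<Rightarrow> tm \<Rightarrow> tm" where
  "subst_tm \<sigma> (Var x) = Var (\<sigma> x)"
| "subst_tm \<sigma> (App M Ns) = App (subst_tm \<sigma> M) (map (subst_tm \<sigma>) Ns)"

primrec subst_val :: "(var \<Rightarrow> var) \<Rightarrow> val \<Rightarrow> val"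
    and subst_decl :: "(var \<Rightarrow> var) \<Rightarrow> decl \<Rightarrow> decl" where
  "subst_val \<sigma> Star = Star"
| "subst_val \<sigma> (Lam ys D) = Lam ys (subst_decl (\<lambda>v. if v \<in> set ys then v else \<sigma> v) D)"
| "subst_decl \<sigma> (Let x V D) = Let x (subst_val \<sigma> V) (subst_decl (\<sigma>(x := x)) D)"
| "subst_decl \<sigma> (Tm M) = Tm (subst_tm \<sigma> M)"

fun mk_sub :: "var list \<Rightarrow> var list \<Rightarrow> var \<Rightarrow> var" where
  "mk_sub (y # ys) (z # zs) = (mk_sub ys zs)(y := z)"
| "mk_sub _ _ = id"

definition lets :: "(var \<times> val) list \<Rightarrow> decl \<Rightarrow> decl" where
  "lets L D = foldr (\<lambda>(x, V) D. Let x V D) L D"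

primrec dlets :: "decl \<Rightarrow> (var \<times> val) list" where
  "dlets (Let x V D) = (x, V) # dlets D"
| "dlets (Tm M) = []"

primrec dbody :: "decl \<Rightarrow> tm" where
  "dbody (Let x V D) = dbody D"
| "dbody (Tm M) = M"

text \<open>A frame (xs, Ms) is @(x1,...,xk,[ ],M1,...,Ml); a term context is a list of frames,
  outermost first.\<close>
type_synonym frame = "var list \<times> tm list"

fun plugF :: "frame \<Rightarrow> tm \<Rightarrow> tm" where
  "plugF (xs, Ms) N = (if xs = [] then App N Ms
                        else App (Var (hd xs)) (map Var (tl xs) @ N # Ms))"

primrec plugC :: "frame list \<Rightarrow> tm \<Rightarrow> tm" where
  "plugC [] N = N"
| "plugC (f # fs) N = plugF f (plugC fs N)"

inductive eqv_val :: "bool \<Rightarrow> val \<Rightarrow> val \<Rightarrow> bool"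
      and eqv_decl :: "bool \<Rightarrow> decl \<Rightarrow> decl \<Rightarrow> bool"
  for ak :: bool where
  refl_v: "wf_val ak V \<Longrightarrow> eqv_val ak V V"
| sym_v: "eqv_val ak V V' \<Longrightarrow> eqv_val ak V' V"
| trans_v: "eqv_val ak V1 V2 \<Longrightarrow> eqv_val ak V2 V3 \<Longrightarrow> eqv_val ak V1 V3"
| refl_d: "wf_decl ak D \<Longrightarrow> eqv_decl ak D D"
| sym_d: "eqv_decl ak D D' \<Longrightarrow> eqv_decl ak D' D"
| trans_d: "eqv_decl ak D1 D2 \<Longrightarrow> eqv_decl ak D2 D3 \<Longrightarrow> eqv_decl ak D1 D3"
| lam_cong: "eqv_decl ak D D' \<Longrightarrow> ys \<noteq> [] \<Longrightarrow> distinct ys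
             \<Longrightarrow> eqv_val ak (Lam ys D) (Lam ys D')"
| let_cong: "eqv_val ak V V' \<Longrightarrow> eqv_decl ak D D' \<Longrightarrow> eqv_decl ak (Let x V D) (Let x V' D')"
| alpha_let: "wf_decl ak (Let x V D) \<Longrightarrow> y \<notin> av_decl D
             \<Longrightarrow> eqv_decl ak (Let x V D) (Let y V (subst_decl (id(x := y)) D))"
| alpha_lam: "wf_val ak (Lam ys D) \<Longrightarrow> length ys' = length ys \<Longrightarrow> distinct ys'
             \<Longrightarrow> set ys' \<inter> av_decl D = {}
             \<Longrightarrow> eqv_val ak (Lam ys D) (Lam ys' (subst_decl (mk_sub ys ys') D))"
| swap: "wf_decl ak (Let x1 V1 (Let x2 V2 D)) \<Longrightarrow> x1 \<noteq> x2 \<Longrightarrow> x1 \<notin> fv_val V2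
         \<Longrightarrow> x2 \<notin> fv_val V1
         \<Longrightarrow> eqv_decl ak (Let x1 V1 (Let x2 V2 D)) (Let x2 V2 (Let x1 V1 D))"
| gc: "wf_decl ak (Let x V D) \<Longrightarrow> x \<notin> fv_decl D \<Longrightarrow> eqv_decl ak (Let x V D) D"

text \<open>E = let Es in C, E' = let Es' in C'.  The redex
  E[let x = \<lambda>ys.D0 in E'[@(x,zs)]] contracts to E[let x = \<lambda>ys.D0 in E'[[zs/ys]D0]],
  lets of a plugged declaration being placed right after the lets of the context.\<close>
inductive red :: "bool \<Rightarrow> decl \<Rightarrow> decl \<Rightarrow> bool" for ak :: bool where
  beta: "Es \<noteq> [] \<Longrightarrow> Es' \<noteq> [] \<Longrightarrow> length zs = length ys
    \<Longrightarrow> LHS = lets Es (Let x (Lam ys D0) (lets Es'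
                 (Tm (plugC C (plugC C' (App (Var x) (map Var zs)))))))
    \<Longrightarrow> Ds = subst_decl (mk_sub ys zs) D0
    \<Longrightarrow> RHS = lets Es (Let x (Lam ys D0) (lets Es' (lets (dlets Ds)
                 (Tm (plugC C (plugC C' (dbody Ds)))))))
    \<Longrightarrow> barendregt LHS \<Longrightarrow> wf_decl ak LHS \<Longrightarrow> wf_decl ak RHS
    \<Longrightarrow> red ak LHS RHS"
| cong: "eqv_decl ak D1 D1' \<Longrightarrow> red ak D1' D2' \<Longrightarrow> eqv_decl ak D2' D2 \<Longrightarrow> red ak D1 D2"

inductive ty_tm :: "(var \<rightharpoonup> ty) \<Rightarrow> tm \<Rightarrow> ty \<Rightarrow> bool" where
  t_var: "\<Gamma> x = Some A \<Longrightarrow> ty_tm \<Gamma> (Var x) A"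
| t_app: "ty_tm \<Gamma> M (Arr As B) \<Longrightarrow> length Ns = length As
          \<Longrightarrow> (\<forall>i < length Ns. ty_tm \<Gamma> (Ns ! i) (As ! i)) \<Longrightarrow> ty_tm \<Gamma> (App M Ns) B"

inductive ty_decl :: "(var \<rightharpoonup> ty) \<Rightarrow> decl \<Rightarrow> ty \<Rightarrow> bool" where
  t_tm: "ty_tm \<Gamma> M A \<Longrightarrow> ty_decl \<Gamma> (Tm M) A"
| t_star: "ty_decl (\<Gamma>(x \<mapsto> Unit)) D A \<Longrightarrow> ty_decl \<Gamma> (Let x Star D) A"
| t_lam: "length As = length ys \<Longrightarrow> ty_decl (\<Gamma>(ys [\<mapsto>] As)) D' C
          \<Longrightarrow> ty_decl (\<Gamma>(x \<mapsto> Arr As C)) D B \<Longrightarrow> ty_decl \<Gamma> (Let x (Lam ys D') D) B"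

fun psi :: "ty \<Rightarrow> ty" where
  "psi Unit = Unit"
| "psi Res = Res"
| "psi (Arr As B) = Arr (map psi As @ [Arr [psi B] Res]) Res"

definition Kty :: "ty \<Rightarrow> ty" where
  "Kty B = Arr [psi B] Res"

definition psi_ctx :: "(var \<rightharpoonup> ty) \<Rightarrow> (var \<rightharpoonup> ty)" where
  "psi_ctx \<Gamma> = map_option psi \<circ> \<Gamma>"

text \<open>cps_list vs ts k = @(vs @ ts) : k, where vs are the already processed variables.\<close>
function cps_list :: "var list \<Rightarrow> tm list \<Rightarrow> var \<Rightarrow> decl" where
  "cps_list [] [] k = Tm (Var k)"
| "cps_list (x # xs) [] k = Tm (App (Var x) (map Var xs @ [Var k]))"
| "cps_list vs (Var x # ts) k = cps_list (vs @ [x]) ts k"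
| "cps_list vs (App M Ms # ts) k =
     (let y = fresh (set vs \<union> \<Union> (set (map fv_tm ts)) \<union> {k} \<union> fv_tm (App M Ms));
          k' = Suc y
      in Let k' (Lam [y] (cps_list (vs @ [y]) ts k)) (cps_list [] (M # Ms) k'))"
  by pat_completeness auto
termination
  by (relation "measure (\<lambda>(vs, ts, k). size_list size ts)") auto

fun cps_tm :: "tm \<Rightarrow> var \<Rightarrow> decl" where
  "cps_tm (Var x) k = Tm (App (Var k) [Var x])"
| "cps_tm (App M Ms) k = cps_list [] (M # Ms) k"

primrec cps_val :: "val \<Rightarrow> val" and cps_decl :: "decl \<Rightarrow> var \<Rightarrow> decl" where
  "cps_val Star = Star"
| "cps_val (Lam ys D) =
     (let k0 = fresh (set ys \<union> av_decl D) in Lam (ys @ [k0]) (cps_decl D k0))"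
| "cps_decl (Let x V D) k = Let x (cps_val V) (cps_decl D k)"
| "cps_decl (Tm M) k = cps_tm M k"

end

theory Submission
  imports Defs
begin

text \<open>Typing is an induction on the typing derivation, since the translation only consults the
  context at the free variables.

  For the simulation, a context \<open>E[@(x\<^sub>1,\<dots>,[ ],\<dots>)]\<close> is translated to \<open>let\<close>-bound continuations
  \<open>k\<^sub>1,\<dots>,k\<^sub>n\<close>, one for each frame, followed by the translation of the hole with continuation \<open>k\<^sub>n\<close>. A
  source redex \<open>@(x,z\<^sup>+)\<close> becomes the redex \<open>@(x,z\<^sup>+,k\<^sub>n)\<close>, whose contractum is the translation of the
  body with continuation \<open>k\<^sub>n\<close>. If the body ends in an application, then commuting its \<open>let\<close>s with those
  of the continuations gives the translation of the source contractum. If it ends in a variable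
  \<open>w\<close> and there is a frame, then the redex \<open>@(k\<^sub>n,w)\<close> has to be contracted as well, after which \<open>k\<^sub>n\<close> is
  garbage. Names are handled by canonical representatives in which binders are numbered by their
  depth: two well-formed declarations with the same canonical form are structurally congruent.\<close>

section \<open>Alpha-equivalence through canonical names\<close>

text \<open>The difficulty is that neither translation nor substitution respects alpha-conversion
  literally: \<open>cps_list\<close> and \<open>cps_val\<close> compute their fresh names from the
  names around them, and \<open>subst_decl\<close> renames without avoiding capture. Moreover a
  conversion from \<open>D\<close> to \<open>D'\<close> may pass through declarations that bind
  \<open>k\<close>, where \<open>cps_decl\<close> would let \<open>k\<close> be captured. So the
  simulation is stated not for \<open>cps_decl\<close> but for the relation
  \<open>cps_rep T \<sigma> D c\<close>, which leaves the bound names of \<open>T\<close> open: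
  every lemma picks names that suit it, and two picks are joined by a structural congruence, which
  reduction absorbs. A capture-avoiding renaming is never computed either: \<open>X\<close> renamed
  by \<open>\<sigma>\<close> is any \<open>Y\<close> with \<open>canon_decl q \<rho> Y = canon_decl
  q (\<rho> \<circ> \<sigma>) X\<close> for all \<open>q\<close> and \<open>\<rho>\<close>. A
  returned variable needs separate treatment because the translation binds a continuation only for a
  frame whose hole holds an application; a variable in the hole is consumed on the spot.\<close>

fun updl :: "('a \<Rightarrow> 'b) \<Rightarrow> 'a list \<Rightarrow> 'b list \<Rightarrow> 'a \<Rightarrow> 'b" where
  "updl \<sigma> (y # ys) (z # zs) = (updl \<sigma> ys zs)(y := z)"
| "updl \<sigma> _ _ = \<sigma>"

text \<open>The base renaming of \<open>updl\<close> is arbitrary because below a binder the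
  renaming collected so far has to be extended; the substitution of the calculus is the base
  \<open>id\<close>.\<close>

lemma mk_sub_updl: "mk_sub ys zs = updl id ys zs"
  by (induction ys zs rule: mk_sub.induct) auto

lemma updl_notin: "v \<notin> set ys \<Longrightarrow> updl \<sigma> ys zs v = \<sigma> v"
  by (induction \<sigma> ys zs rule: updl.induct) auto

lemma updl_in: "v \<in> set ys \<Longrightarrow> length ys = length zs \<Longrightarrow> updl \<sigma> ys zs v \<in> set zs"
  by (induction \<sigma> ys zs rule: updl.induct) auto

lemma updl_apply: "f (updl \<sigma> ys zs v) = updl (f \<circ> \<sigma>) ys (map f zs) v"
  by (induction \<sigma> ys zs rule: updl.induct) auto

lemma updl_cong:
  "(v \<notin> set ys \<Longrightarrow> \<sigma> v = \<sigma>' v) \<Longrightarrow> length ys = length zs \<Longrightarrow> updl \<sigma> ys zs v = updl \<sigma>' ys zs v"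
  by (induction \<sigma> ys zs rule: updl.induct) auto

lemma map_updl: "distinct zs \<Longrightarrow> length zs = length ws \<Longrightarrow> map (updl \<rho> zs ws) zs = ws"
  by (induction \<rho> zs ws rule: updl.induct) (auto intro!: map_cong)

text \<open>Renaming binders from \<open>ys\<close> to \<open>zs\<close> to \<open>ws\<close> may
  skip the middle names. The last hypothesis is absence of capture: a variable outside
  \<open>ys\<close> must not land on an intermediate binder.\<close>

lemma updl_updl:
  assumes "distinct zs" "length ys = length zs" "length zs = length ws"
    and "v \<notin> set ys \<Longrightarrow> \<sigma> v \<notin> set zs"
  shows "updl \<rho> zs ws (updl \<sigma> ys zs v) = updl (\<rho> \<circ> \<sigma>) ys ws v"
proof -
  have "updl \<rho> zs ws (updl \<sigma> ys zs v) = updl (updl \<rho> zs ws \<circ> \<sigma>) ys ws v"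
    using updl_apply[of "updl \<rho> zs ws" \<sigma> ys zs v] map_updl[of zs ws \<rho>] assms by simp
  also have "\<dots> = updl (\<rho> \<circ> \<sigma>) ys ws v"
    by (rule updl_cong) (use assms in \<open>auto simp: updl_notin\<close>)
  finally show ?thesis .
qed

section \<open>Renaming, free variables and well-formedness\<close>

lemma subst_tm_cong: "(\<And>v. v \<in> fv_tm M \<Longrightarrow> \<sigma> v = \<sigma>' v) \<Longrightarrow> subst_tm \<sigma> M = subst_tm \<sigma>' M"
  by (induction M) auto

lemma subst_tm_comp: "subst_tm \<sigma> (subst_tm \<tau> M) = subst_tm (\<sigma> \<circ> \<tau>) M"
  by (induction M) auto

lemma subst_tm_id [simp]: "subst_tm id M = M"
  by (induction M) (auto simp: map_idI)

lemma fv_subst_tm: "fv_tm (subst_tm \<sigma> M) = \<sigma> ` fv_tm M"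
  by (induction M) (auto simp: image_Union)

lemma wf_subst_tm [simp]: "wf_tm (subst_tm \<sigma> M) = wf_tm M"
  by (induction M) (auto simp: list_all_iff)

lemma map_Var_subst: "map (subst_tm \<sigma>) (map Var xs) = map Var (map \<sigma> xs)"
  by simp

lemma flat_subst_tm: "flat_tm M \<Longrightarrow> flat_tm (subst_tm \<sigma> M)"
  unfolding flat_tm_def by (metis map_Var_subst map_is_Nil_conv subst_tm.simps)

lemma finite_fv_tm [simp]: "finite (fv_tm M)"
  by (induction M) auto

lemma finite_fv [simp]: "finite (fv_val V)" "finite (fv_decl D)"
  by (induction V and D rule: val.induct decl.induct) auto

lemma finite_av [simp]: "finite (av_val V)" "finite (av_decl D)"
  by (induction V and D rule: val.induct decl.induct) auto

lemma fv_subset_av: "fv_val V \<subseteq> av_val V" "fv_decl D \<subseteq> av_decl D"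
  by (induction V and D rule: val.induct decl.induct) auto

lemma bnd_subset_av: "set (bnd_val V) \<subseteq> av_val V" "set (bnd_decl D) \<subseteq> av_decl D"
  by (induction V and D rule: val.induct decl.induct) auto

lemma fresh_gt: "finite S \<Longrightarrow> v \<in> S \<Longrightarrow> v < fresh S"
  unfolding fresh_def by (simp add: le_imp_less_Suc)

lemma wf_subst:
  "wf_val ak V \<Longrightarrow> wf_val ak (subst_val \<sigma> V)" "wf_decl ak D \<Longrightarrow> wf_decl ak (subst_decl \<sigma> D)"
  by (induction V and D arbitrary: \<sigma> and \<sigma> rule: val.induct decl.induct)
    (auto simp: flat_subst_tm)

text \<open>A binder met after \<open>i\<close> others is renamed to \<open>n + i\<close> and free variables are renamed by
  \<open>\<sigma>\<close>. Binders are thus de Bruijn levels, and a canonical form depends only on the alpha-class of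
  its argument, even if \<open>\<sigma>\<close> takes values that are captured.\<close>
primrec canon_val :: "nat \<Rightarrow> (var \<Rightarrow> var) \<Rightarrow> val \<Rightarrow> val"
    and canon_decl :: "nat \<Rightarrow> (var \<Rightarrow> var) \<Rightarrow> decl \<Rightarrow> decl" where
  "canon_val n \<sigma> Star = Star"
| "canon_val n \<sigma> (Lam ys D) = Lam [n..<n + length ys]
     (canon_decl (n + length ys) (updl \<sigma> ys [n..<n + length ys]) D)"
| "canon_decl n \<sigma> (Let x V D) = Let n (canon_val n \<sigma> V) (canon_decl (Suc n) (\<sigma>(x := n)) D)"
| "canon_decl n \<sigma> (Tm M) = Tm (subst_tm \<sigma> M)"

lemma canon_cong:
  "(\<And>v. v \<in> fv_val V \<Longrightarrow> \<sigma> v = \<sigma>' v) \<Longrightarrow> canon_val n \<sigma> V = canon_val n \<sigma>' V"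
  "(\<And>v. v \<in> fv_decl D \<Longrightarrow> \<sigma> v = \<sigma>' v) \<Longrightarrow> canon_decl n \<sigma> D = canon_decl n \<sigma>' D"
proof (induction V and D arbitrary: n \<sigma> \<sigma>' and n \<sigma> \<sigma>' rule: val.induct decl.induct)
  case (Lam ys D)
  let ?u = "\<lambda>\<sigma>. updl \<sigma> ys [n..<n + length ys]"
  have "canon_decl (n + length ys) (?u \<sigma>) D = canon_decl (n + length ys) (?u \<sigma>') D"
    by (rule Lam.IH) (rule updl_cong, use Lam.prems in auto)
  then show ?case by simp
next
  case (Let x V D)
  have "canon_val n \<sigma> V = canon_val n \<sigma>' V" by (rule Let.IH) (use Let.prems in auto)
  moreover have "canon_decl (Suc n) (\<sigma>(x:=n)) D = canon_decl (Suc n) (\<sigma>'(x:=n)) D"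
    by (rule Let.IH) (use Let.prems in auto)
  ultimately show ?case by simp
next
  case (Tm M)
  then show ?case by (simp add: subst_tm_cong[of M \<sigma> \<sigma>'])
qed simp

text \<open>\<open>subst_decl\<close> passes binders without renaming them; this is a condition
  under which it is nevertheless the true substitution. Fixed variables are exempt because a free
  occurrence of \<open>v\<close> never lies below a binder \<open>v\<close>.\<close>

definition nocap :: "(var \<Rightarrow> var) \<Rightarrow> var set \<Rightarrow> var list \<Rightarrow> bool" where
  "nocap \<tau> F B \<longleftrightarrow> (\<forall>v\<in>F. \<tau> v = v \<or> \<tau> v \<notin> set B)"

lemma nocapD: "nocap \<tau> F B \<Longrightarrow> v \<in> F \<Longrightarrow> \<tau> v \<in> set B \<Longrightarrow> \<tau> v = v"
  unfolding nocap_def by blast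

text \<open>Canonical forms forget binder names, so a substitution without capture only precomposes
  the renaming of the free variables.\<close>

lemma canon_subst:
  "nocap \<tau> (fv_val V) (bnd_val V) \<Longrightarrow> canon_val n \<sigma> (subst_val \<tau> V) = canon_val n (\<sigma> \<circ> \<tau>) V"
  "nocap \<tau> (fv_decl D) (bnd_decl D) \<Longrightarrow> canon_decl n \<sigma> (subst_decl \<tau> D) = canon_decl n (\<sigma> \<circ> \<tau>) D"
proof (induction V and D arbitrary: n \<sigma> \<tau> and n \<sigma> \<tau> rule: val.induct decl.induct)
  case (Lam ys D)
  let ?n = "n + length ys" and ?\<tau> = "\<lambda>v. if v \<in> set ys then v else \<tau> v"
  have "canon_decl ?n (updl \<sigma> ys [n..<?n]) (subst_decl ?\<tau> D)
     = canon_decl ?n (updl \<sigma> ys [n..<?n] \<circ> ?\<tau>) D"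
    by (rule Lam.IH) (use Lam.prems in \<open>auto simp: nocap_def\<close>)
  also have "\<dots> = canon_decl ?n (updl (\<sigma> \<circ> \<tau>) ys [n..<?n]) D"
  proof (rule canon_cong)
    fix v assume "v \<in> fv_decl D"
    then have "v \<notin> set ys \<Longrightarrow> \<tau> v \<notin> set ys"
      using nocapD[OF Lam.prems, of v] by auto
    then show "(updl \<sigma> ys [n..<?n] \<circ> ?\<tau>) v = updl (\<sigma> \<circ> \<tau>) ys [n..<?n] v"
      by (cases "v \<in> set ys") (auto simp: updl_notin intro: updl_cong)
  qed
  finally show ?case by (simp only: subst_val.simps canon_val.simps)
next
  case (Let x V D)
  have 1: "canon_val n \<sigma> (subst_val \<tau> V) = canon_val n (\<sigma> \<circ> \<tau>) V"
    by (rule Let.IH) (use Let.prems in \<open>auto simp: nocap_def\<close>)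
  have "canon_decl (Suc n) (\<sigma>(x := n)) (subst_decl (\<tau>(x := x)) D)
     = canon_decl (Suc n) (\<sigma>(x := n) \<circ> \<tau>(x := x)) D"
    by (rule Let.IH) (use Let.prems in \<open>auto simp: nocap_def\<close>)
  also have "\<dots> = canon_decl (Suc n) ((\<sigma> \<circ> \<tau>)(x := n)) D"
    by (rule canon_cong) (use nocapD[OF Let.prems] in force)
  finally show ?case using 1 by (simp only: subst_decl.simps canon_decl.simps)
qed (auto simp: subst_tm_comp)

text \<open>The bound on \<open>\<sigma>\<close> keeps the images of free variables apart from the
  levels, which start at \<open>n\<close>.\<close>

lemma fv_canon:
  "(\<And>v. v \<in> fv_val V \<Longrightarrow> \<sigma> v < n) \<Longrightarrow> fv_val (canon_val n \<sigma> V) = \<sigma> ` fv_val V"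
  "(\<And>v. v \<in> fv_decl D \<Longrightarrow> \<sigma> v < n) \<Longrightarrow> fv_decl (canon_decl n \<sigma> D) = \<sigma> ` fv_decl D"
proof (induction V and D arbitrary: n \<sigma> and n \<sigma> rule: val.induct decl.induct)
  case (Lam ys D)
  let ?n = "n + length ys" let ?u = "updl \<sigma> ys [n..<?n]"
  have in_ys: "n \<le> ?u v \<and> ?u v < ?n" if "v \<in> set ys" for v
    using updl_in[of v ys "[n..<?n]" \<sigma>] that by auto
  have notin_ys: "?u v = \<sigma> v" if "v \<notin> set ys" for v
    using that by (rule updl_notin)
  have "fv_decl (canon_decl ?n ?u D) = ?u ` fv_decl D"
  proof (rule Lam.IH)
    fix v assume "v \<in> fv_decl D"
    then show "?u v < ?n"
      using Lam.prems[of v] in_ys[of v] notin_ys[of v] by (cases "v \<in> set ys") auto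
  qed
  moreover have "?u ` fv_decl D - {n..<?n} = \<sigma> ` (fv_decl D - set ys)"
  proof (intro equalityI subsetI)
    fix w assume "w \<in> ?u ` fv_decl D - {n..<?n}"
    then obtain v where v: "v \<in> fv_decl D" "w = ?u v" "\<not> (n \<le> w \<and> w < ?n)" by auto
    then have "v \<notin> set ys" using in_ys by blast
    then show "w \<in> \<sigma> ` (fv_decl D - set ys)" using v notin_ys by auto
  next
    fix w assume "w \<in> \<sigma> ` (fv_decl D - set ys)"
    then obtain v where v: "v \<in> fv_decl D" "v \<notin> set ys" "w = \<sigma> v" by auto
    then show "w \<in> ?u ` fv_decl D - {n..<?n}" using notin_ys[of v] Lam.prems[of v]
      by (auto intro!: image_eqI[of _ _ v])
  qed
  ultimately show ?case by simp
next
  case (Let x V D)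
  have "fv_val (canon_val n \<sigma> V) = \<sigma> ` fv_val V" by (rule Let.IH) (use Let.prems in auto)
  moreover have "fv_decl (canon_decl (Suc n) (\<sigma>(x := n)) D) = (\<sigma>(x := n)) ` fv_decl D"
    by (rule Let.IH) (use Let.prems in \<open>auto intro: less_SucI\<close>)
  moreover have "(\<sigma>(x := n)) ` fv_decl D - {n} = \<sigma> ` (fv_decl D - {x})"
    using Let.prems by fastforce
  ultimately show ?case by (simp add: image_Un)
qed (auto simp: fv_subst_tm)

section \<open>Structural congruence to canonical forms\<close>

lemma size_subst_tm [simp]: "size (subst_tm \<sigma> M) = size M"
  by (induction M) (auto simp: size_list_conv_sum_list intro!: arg_cong[where f = sum_list])

lemma size_subst [simp]:
  "size (subst_val \<sigma> V) = size V" "size (subst_decl \<sigma> D) = size D"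
  by (induction V and D arbitrary: \<sigma> and \<sigma> rule: val.induct decl.induct) auto

lemma av_subst:
  "av_val (subst_val \<sigma> V) \<subseteq> \<sigma> ` av_val V \<union> av_val V"
  "av_decl (subst_decl \<sigma> D) \<subseteq> \<sigma> ` av_decl D \<union> av_decl D"
proof (induction V and D arbitrary: \<sigma> and \<sigma> rule: val.induct decl.induct)
  case (Lam ys D)
  show ?case using Lam.IH[of "\<lambda>v. if v \<in> set ys then v else \<sigma> v"] by auto
next
  case (Let x V D)
  have "av_decl (subst_decl (\<sigma>(x := x)) D) \<subseteq> \<sigma> ` av_decl D \<union> av_decl D \<union> {x}"
    using Let.IH(2)[of "\<sigma>(x := x)"] by fastforce
  then show ?case using Let.IH(1)[of \<sigma>]
    unfolding subst_decl.simps av_decl.simps image_insert image_Un by blast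
qed (auto simp: fv_subst_tm)

text \<open>With \<open>n\<close> above all names each level is fresh, so the binders can be
  converted one after another by the alpha rules. The induction is on size: after such a conversion
  the hypothesis is applied to a renamed body, which is not a subterm.\<close>

lemma eqv_canon:
  "wf_val ak V \<Longrightarrow> \<forall>v\<in>av_val V. v < n \<Longrightarrow> eqv_val ak V (canon_val n id V)"
  "wf_decl ak D \<Longrightarrow> \<forall>v\<in>av_decl D. v < n \<Longrightarrow> eqv_decl ak D (canon_decl n id D)"
proof -
  have "(\<forall>V n. size V = N \<longrightarrow> wf_val ak V \<longrightarrow> (\<forall>v\<in>av_val V. v < n) \<longrightarrow> eqv_val ak V (canon_val n id V))
    \<and> (\<forall>D n. size D = N \<longrightarrow> wf_decl ak D \<longrightarrow> (\<forall>v\<in>av_decl D. v < n) \<longrightarrow> eqv_decl ak D (canon_decl n id D))" for N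
  proof (induction N rule: less_induct)
    case (less N)
    have IHv: "eqv_val ak V (canon_val n id V)" if "size V < N" "wf_val ak V" "\<forall>v\<in>av_val V. v < n" for V n
      using less.IH that by blast
    have IHd: "eqv_decl ak D (canon_decl n id D)" if "size D < N" "wf_decl ak D" "\<forall>v\<in>av_decl D. v < n" for D n
      using less.IH that by blast
    have 1: "eqv_val ak V (canon_val n id V)"
      if V: "size V = N" "wf_val ak V" "\<forall>v\<in>av_val V. v < n" for V n
    proof (cases V)
      case Star
      then show ?thesis by (auto intro: refl_v)
    next
      case (Lam ys D)
      let ?l = "length ys" let ?ys = "[n..<n + length ys]"
      let ?D = "subst_decl (mk_sub ys ?ys) D"
      have sub: "mk_sub ys ?ys v = v \<or> mk_sub ys ?ys v \<in> set ?ys" for v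
        using updl_in[of v ys ?ys id] updl_notin[of v ys id ?ys] by (auto simp: mk_sub_updl)
      have lt: "v < n" if "v \<in> av_decl D" for v using V(3) Lam that by auto
      have *: "eqv_val ak V (Lam ?ys ?D)"
        unfolding Lam by (rule alpha_lam) (use V Lam lt in \<open>auto dest!: lt\<close>)
      have "eqv_decl ak ?D (canon_decl (n + ?l) id ?D)"
      proof (rule IHd)
        show "\<forall>v\<in>av_decl ?D. v < n + ?l"
        proof
          fix v assume "v \<in> av_decl ?D"
          then have "v \<in> mk_sub ys ?ys ` av_decl D \<union> av_decl D"
            using av_subst(2) by blast
          then obtain w where "w \<in> av_decl D" "v = mk_sub ys ?ys w \<or> v = w" by blast
          then show "v < n + ?l" using sub[of w] lt[of w] by auto
        qed
      qed (use V Lam in \<open>auto intro: wf_subst\<close>)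
      \<comment> \<open>The new names are at least \<open>n\<close> and the binders of
        \<open>D\<close> below it, so nothing is captured and the substitution turns into the
        renaming used by \<open>canon_val\<close>.\<close>
      moreover have "canon_decl (n + ?l) id ?D = canon_decl (n + ?l) (updl id ys ?ys) D"
      proof (subst canon_subst)
        show "nocap (mk_sub ys ?ys) (fv_decl D) (bnd_decl D)"
          unfolding nocap_def
        proof
          fix v
          have "set ?ys \<inter> set (bnd_decl D) = {}" using lt bnd_subset_av(2)[of D]
            by (auto simp: subset_iff dest!: lt)
          then show "mk_sub ys ?ys v = v \<or> mk_sub ys ?ys v \<notin> set (bnd_decl D)" using sub[of v] by blast
        qed
      qed (simp add: mk_sub_updl)
      ultimately have "eqv_val ak (Lam ?ys ?D) (canon_val n id V)"
        using V Lam by (auto intro: lam_cong)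
      with * show ?thesis by (rule trans_v)
    qed
    have 2: "eqv_decl ak D0 (canon_decl n id D0)"
      if D: "size D0 = N" "wf_decl ak D0" "\<forall>v\<in>av_decl D0. v < n" for D0 n
    proof (cases D0)
      case (Tm M)
      then show ?thesis using D by (auto intro: refl_d)
    next
      case (Let x V D')
      let ?D = "subst_decl (id(x := n)) D'"
      have "eqv_decl ak D0 (Let n V ?D)"
        unfolding Let by (rule alpha_let) (use D Let in auto)
      moreover have "eqv_decl ak ?D (canon_decl (Suc n) id ?D)"
      proof (rule IHd)
        show "\<forall>v\<in>av_decl ?D. v < Suc n"
        proof
          fix v assume "v \<in> av_decl ?D"
          then have "v = n \<or> v \<in> av_decl D'" using av_subst(2)[of "id(x := n)" D'] by (auto split: if_splits)
          then show "v < Suc n" using D Let by (auto intro: less_SucI)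
        qed
      qed (use D Let in \<open>auto intro: wf_subst\<close>)
      moreover have "canon_decl (Suc n) id ?D = canon_decl (Suc n) (id(x := n)) D'"
      proof (subst canon_subst)
        show "nocap (id(x := n)) (fv_decl D') (bnd_decl D')"
          using D(3) Let bnd_subset_av(2)[of D'] by (auto simp: nocap_def subset_iff)
      qed simp
      moreover have "eqv_val ak V (canon_val n id V)"
        by (rule IHv) (use D Let in auto)
      ultimately show ?thesis unfolding Let by (auto intro: trans_d let_cong)
    qed
    show ?case using 1 2 by blast
  qed
  then show "wf_val ak V \<Longrightarrow> \<forall>v\<in>av_val V. v < n \<Longrightarrow> eqv_val ak V (canon_val n id V)"
    "wf_decl ak D \<Longrightarrow> \<forall>v\<in>av_decl D. v < n \<Longrightarrow> eqv_decl ak D (canon_decl n id D)" by blast+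
qed

text \<open>All levels and renamings are quantified so that the relation is preserved by
  \<open>Let\<close>, which evaluates its body at another level and under another renaming.\<close>

definition alpha_eq_val :: "val \<Rightarrow> val \<Rightarrow> bool" where
  "alpha_eq_val V V' \<longleftrightarrow> (\<forall>n \<sigma>. canon_val n \<sigma> V = canon_val n \<sigma> V')"

definition alpha_eq :: "decl \<Rightarrow> decl \<Rightarrow> bool" where
  "alpha_eq D D' \<longleftrightarrow> (\<forall>n \<sigma>. canon_decl n \<sigma> D = canon_decl n \<sigma> D')"

text \<open>Both sides are congruent to one canonical form, taken at a level above all their
  names.\<close>

lemma alpha_eq_eqv_val:
  assumes "alpha_eq_val V V'" "wf_val ak V" "wf_val ak V'"
  shows "eqv_val ak V V'"
proof -
  let ?n = "fresh (av_val V \<union> av_val V')"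
  have "eqv_val ak V (canon_val ?n id V)" "eqv_val ak V' (canon_val ?n id V')"
    using assms by (auto intro!: eqv_canon fresh_gt)
  then show ?thesis using assms(1) by (metis alpha_eq_val_def sym_v trans_v)
qed

lemma alpha_eq_eqv:
  assumes "alpha_eq D D'" "wf_decl ak D" "wf_decl ak D'"
  shows "eqv_decl ak D D'"
proof -
  let ?n = "fresh (av_decl D \<union> av_decl D')"
  have "eqv_decl ak D (canon_decl ?n id D)" "eqv_decl ak D' (canon_decl ?n id D')"
    using assms by (auto intro!: eqv_canon fresh_gt)
  then show ?thesis using assms(1) by (metis alpha_eq_def sym_d trans_d)
qed

lemma eqv_wf:
  "eqv_val ak V V' \<Longrightarrow> wf_val ak V \<and> wf_val ak V'"
  "eqv_decl ak D D' \<Longrightarrow> wf_decl ak D \<and> wf_decl ak D'"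
  by (induction rule: eqv_val_eqv_decl.inducts) (auto simp: wf_subst)

lemma red_wf: "red ak D D' \<Longrightarrow> wf_decl ak D \<and> wf_decl ak D'"
  by (induction rule: red.induct) (auto dest: eqv_wf)

section \<open>Reduction without the Barendregt convention\<close>

lemma lets_simps [simp]:
  "lets [] D = D" "lets ((x, V) # L) D = Let x V (lets L D)"
  "lets (L @ L') D = lets L (lets L' D)"
  by (simp_all add: lets_def)

lemma lets_dlets [simp]: "lets (dlets D) (Tm (dbody D)) = D"
  by (induction D rule: decl.induct[of "\<lambda>_. True"]) auto

lemma wf_lets [simp]: "wf_decl ak (lets L D) \<longleftrightarrow> (\<forall>(x, V)\<in>set L. wf_val ak V) \<and> wf_decl ak D"
  by (induction L) auto

lemma eqv_lets:
  "eqv_decl ak D D' \<Longrightarrow> \<forall>(x, V)\<in>set L. wf_val ak V \<Longrightarrow> eqv_decl ak (lets L D) (lets L D')"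
  by (induction L) (auto intro!: let_cong refl_v)

lemma fv_lets_cong: "fv_decl D = fv_decl D' \<Longrightarrow> fv_decl (lets L D) = fv_decl (lets L D')"
  by (induction L) auto

lemma fv_lets_subset: "fv_decl D - fst ` set L \<subseteq> fv_decl (lets L D)"
  by (induction L) auto

definition bnd_lets :: "(var \<times> val) list \<Rightarrow> var list" where
  "bnd_lets L = concat (map (\<lambda>(x, V). bnd_val V @ [x]) L)"

lemma bnd_decl_lets: "bnd_decl (lets L D) = bnd_lets L @ bnd_decl D"
  by (induction L) (auto simp: bnd_lets_def)

lemma fst_subset_bnd_lets: "fst ` set L \<subseteq> set (bnd_lets L)"
  by (force simp: bnd_lets_def)

lemma ex_fresh_var: "finite S \<Longrightarrow> \<exists>x::var. x \<notin> S"
  by (simp add: ex_new_if_finite)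

lemma ex_fresh_list:
  assumes "finite S"
  shows "\<exists>xs :: var list. length xs = l \<and> distinct xs \<and> set xs \<inter> S = {}"
  by (rule exI[of _ "[fresh S..<fresh S + l]"]) (use fresh_gt[OF assms] in \<open>auto simp: not_less[symmetric]\<close>)

text \<open>The equations for all \<open>q\<close> and \<open>\<rho>\<close> express, without
  choosing names, that the primed object is a capture-avoiding renaming of the other one by
  \<open>\<sigma>\<close>. Here and in \<open>canon_LetI\<close> such renamings are assembled from
  those of the parts, under binders that may be chosen afresh.\<close>

lemma canon_LamI:
  assumes D': "\<And>q \<rho>. canon_decl q \<rho> D' = canon_decl q (\<rho> \<circ> updl \<sigma> ys ys') D"
    and ys': "length ys = length ys'" "distinct ys'" "set ys' \<inter> \<sigma> ` (fv_decl D - set ys) = {}"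
  shows "canon_val q \<rho> (Lam ys' D') = canon_val q (\<rho> \<circ> \<sigma>) (Lam ys D)"
proof -
  let ?n = "q + length ys"
  have "canon_decl ?n (updl \<rho> ys' [q..<?n] \<circ> updl \<sigma> ys ys') D
     = canon_decl ?n (updl (\<rho> \<circ> \<sigma>) ys [q..<?n]) D"
    by (rule canon_cong, unfold comp_apply[of "updl \<rho> ys' [q..<?n]"], rule updl_updl) (use ys' in auto)
  then show ?thesis using ys'(1) by (simp add: D')
qed

lemma canon_LetI:
  assumes V': "\<And>q \<rho>. canon_val q \<rho> V' = canon_val q (\<rho> \<circ> \<sigma>) V"
    and D': "\<And>q \<rho>. canon_decl q \<rho> D' = canon_decl q (\<rho> \<circ> \<sigma>(x := x')) D"
    and x': "x' \<notin> \<sigma> ` (fv_decl D - {x})"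
  shows "canon_decl q \<rho> (Let x' V' D') = canon_decl q (\<rho> \<circ> \<sigma>) (Let x V D)"
proof -
  have "canon_decl (Suc q) (\<rho>(x' := q) \<circ> \<sigma>(x := x')) D = canon_decl (Suc q) ((\<rho> \<circ> \<sigma>)(x := q)) D"
    by (rule canon_cong) (use x' in auto)
  then show ?thesis by (simp only: canon_decl.simps V' D')
qed

text \<open>Each binder passed is replaced by a fresh one, which changes the renaming of the body;
  hence \<open>\<sigma>\<close> is arbitrary. Binders already spent are added to \<open>S\<close>,
  which keeps all of them distinct.\<close>

lemma ex_uniq:
  "wf_val ak V \<Longrightarrow> finite S \<Longrightarrow> \<exists>V'. (\<forall>q \<rho>. canon_val q \<rho> V' = canon_val q (\<rho> \<circ> \<sigma>) V)
     \<and> wf_val ak V' \<and> distinct (bnd_val V') \<and> set (bnd_val V') \<inter> S = {}"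
  "wf_decl ak D \<Longrightarrow> finite S \<Longrightarrow> \<exists>D'. (\<forall>q \<rho>. canon_decl q \<rho> D' = canon_decl q (\<rho> \<circ> \<sigma>) D)
     \<and> wf_decl ak D' \<and> distinct (bnd_decl D') \<and> set (bnd_decl D') \<inter> S = {}"
proof (induction V and D arbitrary: \<sigma> S and \<sigma> S rule: val.induct decl.induct)
  case Star
  show ?case by (rule exI[of _ Star]) auto
next
  case (Lam ys D)
  obtain ys' where ys': "length ys' = length ys" "distinct ys'" "set ys' \<inter> (S \<union> \<sigma> ` fv_decl D) = {}"
    using ex_fresh_list[of "S \<union> \<sigma> ` fv_decl D"] Lam.prems by auto
  obtain D' where D': "\<And>q \<rho>. canon_decl q \<rho> D' = canon_decl q (\<rho> \<circ> updl \<sigma> ys ys') D"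
    "wf_decl ak D'" "distinct (bnd_decl D')" "set (bnd_decl D') \<inter> (S \<union> set ys') = {}"
    using Lam.IH[of "S \<union> set ys'" "updl \<sigma> ys ys'"] Lam.prems unfolding wf_val.simps
    by (meson List.finite_set finite_UnI)
  have "canon_val q \<rho> (Lam ys' D') = canon_val q (\<rho> \<circ> \<sigma>) (Lam ys D)" for q \<rho>
    by (rule canon_LamI[OF D'(1)]) (use ys' in auto)
  moreover have "wf_val ak (Lam ys' D') \<and> distinct (bnd_val (Lam ys' D')) \<and> set (bnd_val (Lam ys' D')) \<inter> S = {}"
    using ys' D'(2-) Lam.prems by auto
  ultimately show ?case by blast
next
  case (Let x V D)
  obtain x' where x': "x' \<notin> S \<union> \<sigma> ` fv_decl D"
    using ex_fresh_var[of "S \<union> \<sigma> ` fv_decl D"] Let.prems by auto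
  obtain D' where D': "\<And>q \<rho>. canon_decl q \<rho> D' = canon_decl q (\<rho> \<circ> \<sigma>(x := x')) D"
    "wf_decl ak D'" "distinct (bnd_decl D')" "set (bnd_decl D') \<inter> insert x' S = {}"
    using Let.IH(2)[of "insert x' S" "\<sigma>(x := x')"] Let.prems unfolding wf_decl.simps
    by (meson finite_insert)
  obtain V' where V': "\<And>q \<rho>. canon_val q \<rho> V' = canon_val q (\<rho> \<circ> \<sigma>) V"
    "wf_val ak V'" "distinct (bnd_val V')" "set (bnd_val V') \<inter> (insert x' S \<union> set (bnd_decl D')) = {}"
    using Let.IH(1)[of "insert x' S \<union> set (bnd_decl D')" \<sigma>] Let.prems unfolding wf_decl.simps
    by (meson List.finite_set finite_UnI finite_insert)
  have "canon_decl q \<rho> (Let x' V' D') = canon_decl q (\<rho> \<circ> \<sigma>) (Let x V D)" for q \<rho>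
    by (rule canon_LetI[OF V'(1) D'(1)]) (use x' in auto)
  moreover have "wf_decl ak (Let x' V' D') \<and> distinct (bnd_decl (Let x' V' D')) \<and> set (bnd_decl (Let x' V' D')) \<inter> S = {}"
    using x' D'(2-) V'(2-) Let.prems by auto
  ultimately show ?case by blast
next
  case (Tm M)
  show ?case
  proof (intro exI conjI allI)
    show "canon_decl q \<rho> (Tm (subst_tm \<sigma> M)) = canon_decl q (\<rho> \<circ> \<sigma>) (Tm M)" for q \<rho>
      by (simp only: canon_decl.simps subst_tm_comp)
  qed (use Tm.prems in \<open>auto simp: flat_subst_tm\<close>)
qed

text \<open>The names bound by the prefix itself are kept, because whatever is placed below refers
  to them; only the insides of the values vary.\<close>

definition alpha_eq_lets :: "(var \<times> val) list \<Rightarrow> (var \<times> val) list \<Rightarrow> bool" where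
  "alpha_eq_lets = list_all2 (\<lambda>(x, V) (x', V'). x = x' \<and> alpha_eq_val V V')"

lemma alpha_eq_letsI: "alpha_eq_lets L L' \<Longrightarrow> alpha_eq D D' \<Longrightarrow> alpha_eq (lets L D) (lets L' D')"
  unfolding alpha_eq_lets_def by (induction rule: list_all2_induct) (auto simp: alpha_eq_def alpha_eq_val_def)

lemma alpha_eq_Let: "alpha_eq_val V V' \<Longrightarrow> alpha_eq D D' \<Longrightarrow> alpha_eq (Let x V D) (Let x V' D')"
  by (auto simp: alpha_eq_def alpha_eq_val_def)

lemma alpha_eq_refl [simp]: "alpha_eq D D"
  by (simp add: alpha_eq_def)

lemma alpha_eq_fv:
  assumes "alpha_eq D D'"
  shows "fv_decl D = fv_decl D'"
proof -
  let ?n = "fresh (fv_decl D \<union> fv_decl D')"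
  have "fv_decl (canon_decl ?n id D) = fv_decl D" "fv_decl (canon_decl ?n id D') = fv_decl D'"
    by (subst fv_canon; auto intro: fresh_gt)+
  then show ?thesis using assms by (simp add: alpha_eq_def)
qed

text \<open>The prefix names lie in \<open>S\<close> themselves, so the conclusion has to admit them
  as binders, but no other elements of \<open>S\<close>.\<close>

lemma ex_uniq_lets:
  "\<forall>(x, V)\<in>set L. wf_val ak V \<Longrightarrow> finite S \<Longrightarrow> fst ` set L \<subseteq> S \<Longrightarrow> distinct (map fst L) \<Longrightarrow>
   \<exists>L'. alpha_eq_lets L L' \<and> (\<forall>(x, V)\<in>set L'. wf_val ak V) \<and> distinct (bnd_lets L')
     \<and> set (bnd_lets L') \<inter> S \<subseteq> fst ` set L"
proof (induction L)
  case Nil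
  show ?case by (rule exI[of _ "[]"]) (auto simp: alpha_eq_lets_def bnd_lets_def)
next
  case (Cons xV L)
  obtain x V where xV: "xV = (x, V)" by force
  obtain L' where L': "alpha_eq_lets L L'" "\<forall>(x, V)\<in>set L'. wf_val ak V" "distinct (bnd_lets L')"
    "set (bnd_lets L') \<inter> S \<subseteq> fst ` set L"
    using Cons by auto
  obtain V' where V': "\<And>q \<rho>. canon_val q \<rho> V' = canon_val q (\<rho> \<circ> id) V"
    "wf_val ak V'" "distinct (bnd_val V')" "set (bnd_val V') \<inter> (S \<union> set (bnd_lets L')) = {}"
    using ex_uniq(1)[of ak V "S \<union> set (bnd_lets L')" id] Cons.prems xV
    by (metis (no_types, lifting) List.finite_set case_prod_conv finite_UnI list.set_intros(1))
  have b: "bnd_lets ((x, V') # L') = bnd_val V' @ x # bnd_lets L'" by (simp add: bnd_lets_def)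
  have x: "x \<in> S" "x \<notin> set (bnd_lets L')" using Cons.prems xV L'(4) by auto
  show ?case
    by (rule exI[of _ "(x, V') # L'"], unfold b) (use x V' L' in \<open>auto simp: xV alpha_eq_lets_def alpha_eq_val_def\<close>)
qed

text \<open>Before the redex is contracted the values are renamed so that the Barendregt convention
  holds, and a dummy \<open>let\<close> provides the inner context that the rule demands.\<close>
lemma red_beta_general:
  assumes wf: "wf_decl True (lets A (Let x (Lam ys D0) (lets B (Tm (App (Var x) (map Var zs))))))"
    and A: "A \<noteq> []" and len: "length zs = length ys"
    and dist: "distinct (map fst A @ x # map fst B)"
    and disj: "(fst ` set A \<union> {x} \<union> fst ` set B) \<inter>
      fv_decl (lets A (Let x (Lam ys D0) (lets B (Tm (App (Var x) (map Var zs)))))) = {}"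
    and D1: "wf_decl True D1" "\<And>q \<rho>. canon_decl q \<rho> D1 = canon_decl q (\<rho> \<circ> updl id ys zs) D0"
  shows "red True (lets A (Let x (Lam ys D0) (lets B (Tm (App (Var x) (map Var zs))))))
    (lets A (Let x (Lam ys D0) (lets B D1)))" (is "red True ?T ?R")
proof -
  let ?b = "Tm (App (Var x) (map Var zs))"
  let ?S0 = "fst ` set A \<union> {x} \<union> fst ` set B \<union> set zs \<union> fv_decl ?T \<union> fv_decl D0 \<union> fv_decl D1"
  obtain d where d: "d \<notin> ?S0" using ex_fresh_var[of ?S0] by auto
  \<comment> \<open>The sets \<open>S\<close>, \<open>S2\<close>, \<open>S3\<close>,
    \<open>S4\<close> grow by the binders already used, so that the values of \<open>A\<close>, the
    parameters, the procedure body and the values of \<open>B\<close> receive disjoint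
    binders.\<close>
  define S where "S = insert d ?S0"
  have S: "finite S" "fst ` set A \<subseteq> S" "x \<in> S" "fst ` set B \<subseteq> S" "set zs \<subseteq> S" "fv_decl ?T \<subseteq> S"
    "fv_decl D0 \<subseteq> S" "d \<in> S" "d \<noteq> x" "d \<notin> fst ` set A" "d \<notin> fst ` set B"
    "d \<notin> set zs" "d \<notin> fv_decl D1" "d \<notin> fv_decl ?T"
    using d unfolding S_def by auto
  have wfD0: "wf_decl True D0" using wf by auto
  obtain A' where A': "alpha_eq_lets A A'" "\<forall>(x, V)\<in>set A'. wf_val True V" "distinct (bnd_lets A')"
    "set (bnd_lets A') \<inter> S \<subseteq> fst ` set A"
    using ex_uniq_lets[of A True S] wf dist S by auto
  define S2 where "S2 = S \<union> set (bnd_lets A')"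
  have S2: "finite S2" "S \<subseteq> S2" "set (bnd_lets A') \<subseteq> S2" using S(1) unfolding S2_def by auto
  obtain us where us: "length us = length ys" "distinct us" "set us \<inter> S2 = {}"
    using ex_fresh_list[OF S2(1)] by blast
  define S3 where "S3 = S2 \<union> set us"
  have S3: "finite S3" "S2 \<subseteq> S3" "set us \<subseteq> S3" using S2(1) unfolding S3_def by auto
  obtain D where D: "\<And>q \<rho>. canon_decl q \<rho> D = canon_decl q (\<rho> \<circ> updl id ys us) D0"
    "wf_decl True D" "distinct (bnd_decl D)" "set (bnd_decl D) \<inter> S3 = {}"
    using ex_uniq(2)[OF wfD0 S3(1)] by blast
  define S4 where "S4 = S3 \<union> set (bnd_decl D)"
  have S4: "finite S4" "S3 \<subseteq> S4" "set (bnd_decl D) \<subseteq> S4" using S3(1) unfolding S4_def by auto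
  have BS4: "fst ` set B \<subseteq> S4" using S(4) S2(2) S3(2) S4(2) by blast
  obtain B' where B': "alpha_eq_lets B B'" "\<forall>(x, V)\<in>set B'. wf_val True V" "distinct (bnd_lets B')"
    "set (bnd_lets B') \<inter> S4 \<subseteq> fst ` set B"
    using ex_uniq_lets[of B True S4] wf dist S4(1) BS4 by auto
  have names: "x \<notin> fst ` set A" "x \<notin> fst ` set B" "fst ` set A \<inter> fst ` set B = {}" using dist by auto
  have inA: "z \<in> fst ` set A" if "z \<in> set (bnd_lets A')" "z \<in> S" for z using A'(4) that by blast
  have inB: "z \<in> fst ` set B" if "z \<in> set (bnd_lets B')" "z \<in> S4" for z using B'(4) that by blast
  have sub: "S \<subseteq> S4" "set (bnd_lets A') \<subseteq> S4" "set us \<subseteq> S4" "S \<subseteq> S3" "S \<subseteq> S2" "set (bnd_lets A') \<subseteq> S3"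
    using S2 S3 S4 by blast+
  have uS: "z \<notin> set us" if "z \<in> S" for z using us(3) that sub by blast
  have DS: "z \<notin> set (bnd_decl D)" if "z \<in> S" for z using D(4) that sub by blast
  have AB: "set (bnd_lets A') \<inter> set (bnd_lets B') = {}"
  proof (rule ccontr)
    assume "set (bnd_lets A') \<inter> set (bnd_lets B') \<noteq> {}"
    then obtain z where z: "z \<in> set (bnd_lets A')" "z \<in> set (bnd_lets B')" by blast
    have "z \<in> fst ` set B" using z sub inB by blast
    moreover have "z \<in> fst ` set A" using z(1) calculation S(4) inA by blast
    ultimately show False using names by blast
  qed
  have xin: "x \<notin> set (bnd_lets A')" "x \<notin> set (bnd_lets B')" "x \<notin> set us" "x \<notin> set (bnd_decl D)"
    using inA inB names S(3) uS DS sub(1) by blast+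
  have din: "d \<notin> set (bnd_lets A')" "d \<notin> set (bnd_lets B')" "d \<notin> set us" "d \<notin> set (bnd_decl D)"
    using inA inB S(8,10,11) uS DS sub(1) by blast+
  have uA: "set us \<inter> set (bnd_lets A') = {}" "set (bnd_decl D) \<inter> set (bnd_lets A') = {}"
    "set us \<inter> set (bnd_decl D) = {}"
    using us(3) S2(3) D(4) sub(6) S3(3) by blast+
  have uB: "z \<notin> set (bnd_lets B')" if z: "z \<in> set us \<union> set (bnd_decl D)" for z
  proof
    assume "z \<in> set (bnd_lets B')"
    then have "z \<in> S" using inB[of z] z sub(3) S4(3) S(4) by blast
    then show False using z uS DS by blast
  qed
  have disjus: "set us \<inter> id ` (fv_decl D0 - set ys) = {}" using uS S(7) unfolding image_id id_apply by blast
  have "alpha_eq_val (Lam ys D0) (Lam us D)"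
    unfolding alpha_eq_val_def
  proof (intro allI)
    fix q \<rho> show "canon_val q \<rho> (Lam ys D0) = canon_val q \<rho> (Lam us D)"
      using canon_LamI[OF D(1) us(1)[symmetric] us(2), of q \<rho>] disjus
      by (simp only: comp_id)
  qed
  note aeqs = alpha_eq_letsI[OF A'(1) alpha_eq_Let[OF this alpha_eq_letsI[OF B'(1)]]]
  define Td where "Td = lets A (Let x (Lam ys D0) (lets B (Let d Star ?b)))"
  define T' where "T' = lets A' (Let x (Lam us D) (lets (B' @ [(d, Star)]) ?b))"
  define Ds where "Ds = subst_decl (mk_sub us zs) D"
  define R' where "R' = lets A' (Let x (Lam us D) (lets (B' @ [(d, Star)]) Ds))"
  define Rd where "Rd = lets A (Let x (Lam ys D0) (lets B (Let d Star D1)))"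
  have wfT': "wf_decl True T'" using A' B' us D wf by (auto simp: T'_def)
  have wfR': "wf_decl True R'" using A' B' us D wf by (auto simp: R'_def Ds_def wf_subst)
  have wfTd: "wf_decl True Td" "wf_decl True Rd" using wf D1 by (auto simp: Td_def Rd_def)
  have bd: "d \<notin> fv_decl ?b" using S by auto
  have 1: "eqv_decl True ?T Td"
  proof -
    have "eqv_decl True ?b (Let d Star ?b)" 
      by (rule sym_d[OF gc]) (use bd wf in auto)
    then have "eqv_decl True (lets (A @ (x, Lam ys D0) # B) ?b) (lets (A @ (x, Lam ys D0) # B) (Let d Star ?b))"
      by (rule eqv_lets) (use wf in auto)
    then show ?thesis by (simp add: Td_def)
  qed
  have aeqT: "alpha_eq Td T'" unfolding Td_def T'_def by (simp add: aeqs)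
  then have 2: "eqv_decl True Td T'" using wfTd wfT' by (auto intro: alpha_eq_eqv)
  have fvT': "fv_decl T' = fv_decl ?T"
  proof -
    have "fv_decl (Let d Star ?b) = fv_decl ?b" using bd by auto
    then have "fv_decl (lets (A @ (x, Lam ys D0) # B) (Let d Star ?b)) = fv_decl (lets (A @ (x, Lam ys D0) # B) ?b)"
      by (rule fv_lets_cong)
    then have "fv_decl Td = fv_decl ?T" by (simp add: Td_def)
    then show ?thesis using alpha_eq_fv[OF aeqT] by simp
  qed
  have bT: "bnd_decl T' = bnd_lets A' @ us @ bnd_decl D @ x # bnd_lets B' @ [d]"
    by (simp add: T'_def bnd_decl_lets)
  have bar: "barendregt T'"
    unfolding barendregt_def bT fvT'
  proof
    have "set us \<inter> set (bnd_lets B') = {}" "set (bnd_decl D) \<inter> set (bnd_lets B') = {}"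
      using uB by blast+
    then show "distinct (bnd_lets A' @ us @ bnd_decl D @ x # bnd_lets B' @ [d])"
      using A'(3) B'(3) us(2) D(3) AB xin din S(9) uA by auto
    have "z \<notin> fv_decl ?T" if "z \<in> set (bnd_lets A') \<or> z \<in> set (bnd_lets B')" for z
      using that inA[of z] inB[of z] S(6) sub(1) disj by blast
    moreover have "z \<notin> fv_decl ?T" if "z \<in> set us \<or> z \<in> set (bnd_decl D)" for z
      using that uS[of z] DS[of z] S(6) by blast
    moreover have "x \<notin> fv_decl ?T" "d \<notin> fv_decl ?T" using disj S(14) by blast+
    ultimately show "set (bnd_lets A' @ us @ bnd_decl D @ x # bnd_lets B' @ [d]) \<inter> fv_decl ?T = {}"
      unfolding set_append set_simps by blast
  qed
  \<comment> \<open>Terms of the target are flat, so both term contexts of the rule are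
    empty.\<close>
  have 3: "red True T' R'"
  proof (rule beta[of A' "B' @ [(d, Star)]" zs us T' x D "[]" "[]" Ds])
    show "A' \<noteq> []" using A A'(1) by (auto simp: alpha_eq_lets_def)
    show "R' = lets A' (Let x (Lam us D) (lets (B' @ [(d, Star)])
                (lets (dlets Ds) (Tm (plugC [] (plugC [] (dbody Ds)))))))"
      unfolding R'_def plugC.simps(1) by (simp only: lets_dlets)
    show "T' = lets A' (Let x (Lam us D) (lets (B' @ [(d, Star)]) (Tm (plugC [] (plugC [] (App (Var x) (map Var zs)))))))"
      by (simp add: T'_def)
  qed (use len us bar wfT' wfR' in \<open>simp_all add: Ds_def\<close>)
  \<comment> \<open>The rule produces \<open>D\<close> with \<open>zs\<close> for \<open>us\<close>.
    Since \<open>D\<close> arose from \<open>D0\<close> by renaming \<open>ys\<close> to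
    \<open>us\<close>, the composite takes \<open>ys\<close> to \<open>zs\<close>, as is required of
    \<open>D1\<close>.\<close>
  have "alpha_eq D1 Ds"
    unfolding alpha_eq_def
  proof (intro allI)
    fix q \<rho>
    have sbst: "mk_sub us zs v = v \<or> mk_sub us zs v \<in> set zs" for v
      using updl_in[of v us zs id] updl_notin[of v us id zs] us len by (auto simp: mk_sub_updl)
    have "canon_decl q \<rho> Ds = canon_decl q (\<rho> \<circ> mk_sub us zs) D"
      unfolding Ds_def
    proof (rule canon_subst)
      show "nocap (mk_sub us zs) (fv_decl D) (bnd_decl D)"
        unfolding nocap_def using sbst DS S(5) by blast
    qed
    also have "\<dots> = canon_decl q (\<rho> \<circ> updl id us zs \<circ> updl id ys us) D0"
      by (simp add: D(1) mk_sub_updl)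
    also have "\<dots> = canon_decl q (\<rho> \<circ> updl id ys zs) D0"
    proof (rule canon_cong)
      fix v assume v: "v \<in> fv_decl D0"
      have "updl id us zs (updl id ys us v) = updl (id \<circ> id) ys zs v"
        by (rule updl_updl) (use us len uS S(7) v in auto)
      then show "(\<rho> \<circ> updl id us zs \<circ> updl id ys us) v = (\<rho> \<circ> updl id ys zs) v" by simp
    qed
    finally show "canon_decl q \<rho> D1 = canon_decl q \<rho> Ds" by (simp add: D1)
  qed
  then have "alpha_eq Rd R'" unfolding Rd_def R'_def lets_simps by (intro aeqs alpha_eq_Let) (simp_all add: alpha_eq_val_def)
  then have 4: "eqv_decl True R' Rd" using wfTd wfR' by (auto intro: alpha_eq_eqv sym_d)
  have 5: "eqv_decl True Rd ?R"
  proof -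
    have "eqv_decl True (Let d Star D1) D1" 
      by (rule gc) (use S D1 in auto)
    then have "eqv_decl True (lets (A @ (x, Lam ys D0) # B) (Let d Star D1)) (lets (A @ (x, Lam ys D0) # B) D1)"
      by (rule eqv_lets) (use wf in auto)
    then show ?thesis by (simp add: Rd_def)
  qed
  show ?thesis by (rule cong[OF trans_d[OF 1 2] 3 trans_d[OF 4 5]])
qed

section \<open>Canonical CPS images and structural congruence\<close>

lemma updl_append: "length ys = length ys' \<Longrightarrow> updl \<sigma> (ys @ zs) (ys' @ zs') = updl (updl \<sigma> zs zs') ys ys'"
  by (induction \<sigma> ys ys' rule: updl.induct) auto

lemma updl_id: "updl id ys ys v = v"
  by (induction ys) auto

text \<open>The CPS translation composed with \<open>canon_decl\<close>: the fresh names are levels as well, so no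
  choice of names is left and the result depends only on the alpha-class of the source.\<close>
function ccps_list :: "nat \<Rightarrow> var list \<Rightarrow> tm list \<Rightarrow> var \<Rightarrow> decl" where
  "ccps_list n [] [] k = Tm (Var k)"
| "ccps_list n (x # xs) [] k = Tm (App (Var x) (map Var xs @ [Var k]))"
| "ccps_list n vs (Var x # ts) k = ccps_list n (vs @ [x]) ts k"
| "ccps_list n vs (App M Ms # ts) k = Let n (Lam [n] (ccps_list (Suc n) (vs @ [n]) ts k)) (ccps_list (Suc n) [] (M # Ms) n)"
  by pat_completeness auto
termination
  by (relation "measure (\<lambda>(n, vs, ts, k). size_list size ts)") auto

fun ccps_tm :: "nat \<Rightarrow> tm \<Rightarrow> var \<Rightarrow> decl" where
  "ccps_tm n (Var x) k = Tm (App (Var k) [Var x])"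
| "ccps_tm n (App M Ms) k = ccps_list n [] (M # Ms) k"

primrec ccps_val :: "nat \<Rightarrow> (var \<Rightarrow> var) \<Rightarrow> val \<Rightarrow> val"
    and ccps_decl :: "nat \<Rightarrow> (var \<Rightarrow> var) \<Rightarrow> decl \<Rightarrow> var \<Rightarrow> decl" where
  "ccps_val n \<sigma> Star = Star"
| "ccps_val n \<sigma> (Lam ys D) = Lam [n..<Suc (n + length ys)]
     (ccps_decl (Suc (n + length ys)) (updl \<sigma> ys [n..<n + length ys]) D (n + length ys))"
| "ccps_decl n \<sigma> (Let x V D) c = Let n (ccps_val n \<sigma> V) (ccps_decl (Suc n) (\<sigma>(x := n)) D c)"
| "ccps_decl n \<sigma> (Tm M) c = ccps_tm n (subst_tm \<sigma> M) c"

text \<open>The generated names do not occur in the input, so updating \<open>\<rho>\<close> at them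
  leaves the images of \<open>vs\<close>, \<open>ts\<close> and \<open>k\<close> unchanged. The
  parameter \<open>y\<close> and the binder \<open>k'\<close> both get level \<open>q\<close>, since
  the value bound by a \<open>Let\<close> is outside the scope of its variable.\<close>

lemma canon_cps_list:
  "canon_decl q \<rho> (cps_list vs ts k) = ccps_list q (map \<rho> vs) (map (subst_tm \<rho>) ts) (\<rho> k)"
proof (induction vs ts k arbitrary: q \<rho> rule: cps_list.induct)
  case (4 vs M Ms ts k)
  define S where "S = set vs \<union> \<Union> (set (map fv_tm ts)) \<union> {k} \<union> fv_tm (App M Ms)"
  have finS: "finite S" by (auto simp: S_def)
  define y where "y = fresh S"
  have y: "y \<notin> S" "Suc y \<notin> S" using fresh_gt[OF finS, of y] fresh_gt[OF finS, of "Suc y"] by (auto simp: y_def)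
  have "map (\<rho>(y := q)) vs = map \<rho> vs" "map (subst_tm (\<rho>(y := q))) ts = map (subst_tm \<rho>) ts" "(\<rho>(y := q)) k = \<rho> k"
    using y by (auto simp: S_def intro!: subst_tm_cong)
  moreover have "canon_decl (Suc q) (\<rho>(y := q)) (cps_list (vs @ [y]) ts k)
      = ccps_list (Suc q) (map (\<rho>(y := q)) (vs @ [y])) (map (subst_tm (\<rho>(y := q))) ts) ((\<rho>(y := q)) k)"
    by (rule "4.IH"(1)[OF y_def[unfolded S_def] refl])
  ultimately have 1: "canon_decl (Suc q) (\<rho>(y := q)) (cps_list (vs @ [y]) ts k)
      = ccps_list (Suc q) (map \<rho> vs @ [q]) (map (subst_tm \<rho>) ts) (\<rho> k)"
    by (simp only: map_append list.map fun_upd_same)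
  have "map (subst_tm (\<rho>(Suc y := q))) (M # Ms) = map (subst_tm \<rho>) (M # Ms)"
    using y by (auto simp: S_def intro!: subst_tm_cong)
  moreover have "canon_decl (Suc q) (\<rho>(Suc y := q)) (cps_list [] (M # Ms) (Suc y))
      = ccps_list (Suc q) (map (\<rho>(Suc y := q)) []) (map (subst_tm (\<rho>(Suc y := q))) (M # Ms)) ((\<rho>(Suc y := q)) (Suc y))"
    by (rule "4.IH"(2)[OF y_def[unfolded S_def] refl])
  ultimately have 2: "canon_decl (Suc q) (\<rho>(Suc y := q)) (cps_list [] (M # Ms) (Suc y))
      = ccps_list (Suc q) [] (map (subst_tm \<rho>) (M # Ms)) q"
    by (simp only: list.map(1) fun_upd_same)
  have "cps_list vs (App M Ms # ts) k = Let (Suc y) (Lam [y] (cps_list (vs @ [y]) ts k)) (cps_list [] (M # Ms) (Suc y))"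
    by (simp only: cps_list.simps Let_def y_def S_def)
  then show ?case using 1 2 by simp
qed auto

lemma canon_cps_tm: "canon_decl q \<rho> (cps_tm M k) = ccps_tm q (subst_tm \<rho> M) (\<rho> k)"
  by (cases M) (auto simp: canon_cps_list)

text \<open>The first hypothesis excludes the junk equation for two empty lists, whose result
  \<open>Tm (Var k)\<close> is not flat.\<close>

lemma wf_cps_list: "vs \<noteq> [] \<or> ts \<noteq> [] \<Longrightarrow> list_all wf_tm ts \<Longrightarrow> wf_decl True (cps_list vs ts k)"
proof (induction vs ts k rule: cps_list.induct)
  case (2 x xs k)
  then show ?case by (auto simp: flat_tm_def intro!: exI[of _ "xs @ [k]"])
next
  case (4 vs M Ms ts k)
  then show ?case by (auto simp: Let_def list_all_iff)
qed auto

lemma wf_cps_tm: "wf_tm M \<Longrightarrow> wf_decl True (cps_tm M k)"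
  by (cases M) (auto intro!: wf_cps_list exI[of _ "[x]" for x] simp: list_all_iff flat_tm_def)

lemma fv_ccps_list:
  "\<forall>v\<in>set vs \<union> \<Union> (set (map fv_tm ts)) \<union> {k}. v < n \<Longrightarrow>
   fv_decl (ccps_list n vs ts k) \<subseteq> set vs \<union> \<Union> (set (map fv_tm ts)) \<union> {k}"
proof (induction n vs ts k rule: ccps_list.induct)
  case (3 n vs x ts k)
  then show ?case by auto
next
  case (4 n vs M Ms ts k)
  have "fv_decl (ccps_list (Suc n) (vs @ [n]) ts k) \<subseteq> set (vs @ [n]) \<union> \<Union> (set (map fv_tm ts)) \<union> {k}"
    by (rule "4.IH"(1)) (use "4.prems" in \<open>auto intro: less_SucI\<close>)
  moreover have "fv_decl (ccps_list (Suc n) [] (M # Ms) n) \<subseteq> set [] \<union> \<Union> (set (map fv_tm (M # Ms))) \<union> {n}"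
    by (rule "4.IH"(2)) (use "4.prems" in \<open>auto intro: less_SucI\<close>)
  ultimately show ?case by auto
qed auto

lemma fv_ccps_tm: "\<forall>v\<in>insert k (fv_tm M). v < n \<Longrightarrow> fv_decl (ccps_tm n M k) \<subseteq> insert k (fv_tm M)"
proof (cases M)
  case (App N Ms)
  assume "\<forall>v\<in>insert k (fv_tm M). v < n"
  then show ?thesis using fv_ccps_list[of "[]" "N # Ms" k n] App by auto
qed auto

text \<open>As in \<open>fv_canon\<close>, images and \<open>c\<close> must stay below the levels.
  An upper bound suffices because it serves to discharge freshness conditions.\<close>

lemma fv_ccps:
  "(\<And>v. v \<in> fv_val V \<Longrightarrow> \<sigma> v < n) \<Longrightarrow> fv_val (ccps_val n \<sigma> V) \<subseteq> \<sigma> ` fv_val V"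
  "(\<And>v. v \<in> fv_decl D \<Longrightarrow> \<sigma> v < n) \<Longrightarrow> c < n \<Longrightarrow> fv_decl (ccps_decl n \<sigma> D c) \<subseteq> insert c (\<sigma> ` fv_decl D)"
proof (induction V and D arbitrary: n \<sigma> and n \<sigma> c rule: val.induct decl.induct)
  case (Lam ys D)
  let ?n = "n + length ys" let ?u = "updl \<sigma> ys [n..<?n]"
  have in_ys: "n \<le> ?u v \<and> ?u v < ?n" if "v \<in> set ys" for v
    using updl_in[of v ys "[n..<?n]" \<sigma>] that by auto
  have notin_ys: "?u v = \<sigma> v" if "v \<notin> set ys" for v
    using that by (rule updl_notin)
  have "fv_decl (ccps_decl (Suc ?n) ?u D ?n) \<subseteq> insert ?n (?u ` fv_decl D)"
  proof (rule Lam.IH)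
    fix v assume "v \<in> fv_decl D"
    then show "?u v < Suc ?n"
      using Lam.prems[of v] in_ys[of v] notin_ys[of v] by (cases "v \<in> set ys") auto
  qed simp
  moreover have "?u ` fv_decl D - {n..<?n} \<subseteq> \<sigma> ` (fv_decl D - set ys)"
  proof
    fix w assume "w \<in> ?u ` fv_decl D - {n..<?n}"
    then obtain v where v: "v \<in> fv_decl D" "w = ?u v" "\<not> (n \<le> w \<and> w < ?n)" by auto
    then have "v \<notin> set ys" using in_ys by blast
    then show "w \<in> \<sigma> ` (fv_decl D - set ys)" using v notin_ys by auto
  qed
  ultimately show ?case by (auto simp: less_Suc_eq)
next
  case (Let x V D)
  have "fv_val (ccps_val n \<sigma> V) \<subseteq> \<sigma> ` fv_val V" by (rule Let.IH) (use Let.prems in auto)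
  moreover have "fv_decl (ccps_decl (Suc n) (\<sigma>(x := n)) D c) \<subseteq> insert c ((\<sigma>(x := n)) ` fv_decl D)"
    by (rule Let.IH) (use Let.prems in \<open>auto intro: less_SucI\<close>)
  moreover have "(\<sigma>(x := n)) ` fv_decl D - {n} \<subseteq> \<sigma> ` (fv_decl D - {x})"
    by auto
  ultimately show ?case by auto
next
  case (Tm M)
  then show ?case using fv_ccps_tm[of c "subst_tm \<sigma> M" n] by (auto simp: fv_subst_tm)
qed auto

lemma ccps_cong:
  "(\<And>v. v \<in> fv_val V \<Longrightarrow> \<sigma> v = \<sigma>' v) \<Longrightarrow> ccps_val n \<sigma> V = ccps_val n \<sigma>' V"
  "(\<And>v. v \<in> fv_decl D \<Longrightarrow> \<sigma> v = \<sigma>' v) \<Longrightarrow> ccps_decl n \<sigma> D c = ccps_decl n \<sigma>' D c"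
proof (induction V and D arbitrary: n \<sigma> \<sigma>' and n \<sigma> \<sigma>' c rule: val.induct decl.induct)
  case (Lam ys D)
  let ?u = "\<lambda>\<sigma>. updl \<sigma> ys [n..<n + length ys]"
  have "ccps_decl (Suc (n + length ys)) (?u \<sigma>) D (n + length ys)
      = ccps_decl (Suc (n + length ys)) (?u \<sigma>') D (n + length ys)"
    by (rule Lam.IH) (rule updl_cong, use Lam.prems in auto)
  then show ?case by simp
next
  case (Let x V D)
  have "ccps_val n \<sigma> V = ccps_val n \<sigma>' V" by (rule Let.IH) (use Let.prems in auto)
  moreover have "ccps_decl (Suc n) (\<sigma>(x:=n)) D c = ccps_decl (Suc n) (\<sigma>'(x:=n)) D c"
    by (rule Let.IH) (use Let.prems in auto)
  ultimately show ?case by simp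
next
  case (Tm M)
  then show ?case by (simp add: subst_tm_cong[of M \<sigma> \<sigma>'])
qed simp

text \<open>The continuation \<open>c\<close> is passed on unrenamed and the generated names are
  levels, so capture can only come from binders of the source.\<close>

lemma ccps_subst:
  "nocap \<tau> (fv_val V) (bnd_val V) \<Longrightarrow> ccps_val n \<sigma> (subst_val \<tau> V) = ccps_val n (\<sigma> \<circ> \<tau>) V"
  "nocap \<tau> (fv_decl D) (bnd_decl D) \<Longrightarrow> ccps_decl n \<sigma> (subst_decl \<tau> D) c = ccps_decl n (\<sigma> \<circ> \<tau>) D c"
proof (induction V and D arbitrary: n \<sigma> \<tau> and n \<sigma> \<tau> c rule: val.induct decl.induct)
  case (Lam ys D)
  let ?n = "n + length ys" and ?\<tau> = "\<lambda>v. if v \<in> set ys then v else \<tau> v"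
  have "ccps_decl (Suc ?n) (updl \<sigma> ys [n..<?n]) (subst_decl ?\<tau> D) ?n
     = ccps_decl (Suc ?n) (updl \<sigma> ys [n..<?n] \<circ> ?\<tau>) D ?n"
    by (rule Lam.IH) (use Lam.prems in \<open>auto simp: nocap_def\<close>)
  also have "\<dots> = ccps_decl (Suc ?n) (updl (\<sigma> \<circ> \<tau>) ys [n..<?n]) D ?n"
  proof (rule ccps_cong)
    fix v assume "v \<in> fv_decl D"
    then have "v \<notin> set ys \<Longrightarrow> \<tau> v \<notin> set ys"
      using nocapD[OF Lam.prems, of v] by auto
    then show "(updl \<sigma> ys [n..<?n] \<circ> ?\<tau>) v = updl (\<sigma> \<circ> \<tau>) ys [n..<?n] v"
      by (cases "v \<in> set ys") (auto simp: updl_notin intro: updl_cong)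
  qed
  finally show ?case by (simp only: subst_val.simps ccps_val.simps)
next
  case (Let x V D)
  have 1: "ccps_val n \<sigma> (subst_val \<tau> V) = ccps_val n (\<sigma> \<circ> \<tau>) V"
    by (rule Let.IH) (use Let.prems in \<open>auto simp: nocap_def\<close>)
  have "ccps_decl (Suc n) (\<sigma>(x := n)) (subst_decl (\<tau>(x := x)) D) c
     = ccps_decl (Suc n) (\<sigma>(x := n) \<circ> \<tau>(x := x)) D c"
    by (rule Let.IH) (use Let.prems in \<open>auto simp: nocap_def\<close>)
  also have "\<dots> = ccps_decl (Suc n) ((\<sigma> \<circ> \<tau>)(x := n)) D c"
    by (rule ccps_cong) (use nocapD[OF Let.prems] in force)
  finally show ?case using 1 by (simp only: subst_decl.simps ccps_decl.simps)
qed (auto simp: subst_tm_comp)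

text \<open>\<open>T\<close> is, up to alpha, the translation with continuation \<open>c\<close> of \<open>D\<close> renamed by \<open>\<sigma>\<close>.
  Ranging over all \<open>\<sigma>\<close> and \<open>c\<close> is what makes the simulation independent of clashes between the
  continuation variable and the names in intermediate terms of a conversion.\<close>
definition cps_repv :: "val \<Rightarrow> (var \<Rightarrow> var) \<Rightarrow> val \<Rightarrow> bool" where
  "cps_repv T \<sigma> V \<longleftrightarrow> wf_val True T \<and> (\<forall>q \<rho>. canon_val q \<rho> T = ccps_val q (\<rho> \<circ> \<sigma>) V)"

definition cps_rep :: "decl \<Rightarrow> (var \<Rightarrow> var) \<Rightarrow> decl \<Rightarrow> var \<Rightarrow> bool" where
  "cps_rep T \<sigma> D c \<longleftrightarrow> wf_decl True T \<and> (\<forall>q \<rho>. canon_decl q \<rho> T = ccps_decl q (\<rho> \<circ> \<sigma>) D (\<rho> c))"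

lemma rep_wf: "cps_repv T' \<sigma> V \<Longrightarrow> wf_val True T'" "cps_rep T \<sigma> D c \<Longrightarrow> wf_decl True T"
  by (auto simp: cps_rep_def cps_repv_def)

text \<open>Representatives have prescribed canonical forms, hence equal ones. Separate arguments
  may therefore choose different names and still be joined.\<close>

lemma rep_unique:
  "cps_repv U \<sigma> V \<Longrightarrow> cps_repv U' \<sigma> V \<Longrightarrow> eqv_val True U U'"
  "cps_rep T \<sigma> D c \<Longrightarrow> cps_rep T' \<sigma> D c \<Longrightarrow> eqv_decl True T T'"
  by (auto simp: cps_rep_def cps_repv_def alpha_eq_def alpha_eq_val_def intro!: alpha_eq_eqv alpha_eq_eqv_val)

lemma repv_fv:
  assumes "cps_repv T \<sigma> V"
  shows "fv_val T \<subseteq> \<sigma> ` fv_val V"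
proof -
  let ?S = "fv_val T \<union> \<sigma> ` fv_val V" let ?n = "fresh ?S"
  have n: "v < ?n" if "v \<in> ?S" for v by (rule fresh_gt) (use that in auto)
  have "fv_val (canon_val ?n id T) = id ` fv_val T" by (rule fv_canon) (use n in auto)
  moreover have "canon_val ?n id T = ccps_val ?n (id \<circ> \<sigma>) V" using assms unfolding cps_repv_def by blast
  moreover have "fv_val (ccps_val ?n (id \<circ> \<sigma>) V) \<subseteq> (id \<circ> \<sigma>) ` fv_val V" by (rule fv_ccps) (use n in auto)
  ultimately show ?thesis by simp
qed

lemma rep_fv:
  assumes "cps_rep T \<sigma> D c"
  shows "fv_decl T \<subseteq> insert c (\<sigma> ` fv_decl D)"
proof -
  let ?S = "fv_decl T \<union> insert c (\<sigma> ` fv_decl D)" let ?n = "fresh ?S"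
  have n: "v < ?n" if "v \<in> ?S" for v by (rule fresh_gt) (use that in auto)
  have "fv_decl (canon_decl ?n id T) = id ` fv_decl T" by (rule fv_canon) (use n in auto)
  moreover have "canon_decl ?n id T = ccps_decl ?n (id \<circ> \<sigma>) D (id c)" using assms unfolding cps_rep_def by blast
  moreover have "fv_decl (ccps_decl ?n (id \<circ> \<sigma>) D (id c)) \<subseteq> insert (id c) ((id \<circ> \<sigma>) ` fv_decl D)" by (rule fv_ccps) (use n in auto)
  ultimately show ?thesis by simp
qed

lemma rep_cong:
  assumes "cps_rep T \<sigma> D c" "\<And>v. v \<in> fv_decl D \<Longrightarrow> \<sigma> v = \<sigma>' v"
  shows "cps_rep T \<sigma>' D c"
proof -
  have "ccps_decl q (\<rho> \<circ> \<sigma>) D (\<rho> c) = ccps_decl q (\<rho> \<circ> \<sigma>') D (\<rho> c)" for q \<rho>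
    by (rule ccps_cong) (use assms(2) in auto)
  then show ?thesis using assms(1) unfolding cps_rep_def by metis
qed

lemma repv_cong:
  assumes "cps_repv T \<sigma> V" "\<And>v. v \<in> fv_val V \<Longrightarrow> \<sigma> v = \<sigma>' v"
  shows "cps_repv T \<sigma>' V"
proof -
  have "ccps_val q (\<rho> \<circ> \<sigma>) V = ccps_val q (\<rho> \<circ> \<sigma>') V" for q \<rho>
    by (rule ccps_cong) (use assms(2) in auto)
  then show ?thesis using assms(1) unfolding cps_repv_def by metis
qed

lemma rep_subst:
  "nocap \<tau> (fv_decl D) (bnd_decl D) \<Longrightarrow> cps_rep T \<sigma> (subst_decl \<tau> D) c \<longleftrightarrow> cps_rep T (\<sigma> \<circ> \<tau>) D c"
  by (simp only: cps_rep_def ccps_subst comp_assoc)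

lemma rep_Tm: "wf_tm M \<Longrightarrow> cps_rep (cps_tm (subst_tm \<sigma> M) c) \<sigma> (Tm M) c"
  unfolding cps_rep_def by (simp only: canon_cps_tm wf_cps_tm wf_subst_tm subst_tm_comp ccps_decl.simps) simp

lemma repv_Star: "cps_repv Star \<sigma> Star"
  by (simp add: cps_repv_def)

text \<open>The target binder \<open>x'\<close> may be any name that captures nothing; this freedom
  lets two sources be translated with the same binder.\<close>

lemma rep_Let:
  assumes V': "cps_repv V' \<sigma> V" and D': "cps_rep D' (\<sigma>(x := x')) D c"
    and x': "x' \<notin> \<sigma> ` (fv_decl D - {x})" "x' \<noteq> c"
  shows "cps_rep (Let x' V' D') \<sigma> (Let x V D) c"
  unfolding cps_rep_def
proof (intro conjI allI)
  fix q \<rho>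
  have "ccps_decl (Suc q) (\<rho>(x' := q) \<circ> \<sigma>(x := x')) D (\<rho> c) = ccps_decl (Suc q) ((\<rho> \<circ> \<sigma>)(x := q)) D (\<rho> c)"
    by (rule ccps_cong) (use x' in auto)
  moreover have "canon_decl (Suc q) (\<rho>(x' := q)) D' = ccps_decl (Suc q) (\<rho>(x' := q) \<circ> \<sigma>(x := x')) D ((\<rho>(x' := q)) c)"
    using D' unfolding cps_rep_def by blast
  moreover have "canon_val q \<rho> V' = ccps_val q (\<rho> \<circ> \<sigma>) V" using V' unfolding cps_repv_def by blast
  ultimately show "canon_decl q \<rho> (Let x' V' D') = ccps_decl q (\<rho> \<circ> \<sigma>) (Let x V D) (\<rho> c)"
    using x'(2) by (simp only: canon_decl.simps ccps_decl.simps fun_upd_other[OF x'(2)[symmetric]])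
qed (use rep_wf(1)[OF V'] rep_wf(2)[OF D'] in simp)

lemma repv_Lam:
  assumes D': "cps_rep D' (updl \<sigma> ys ys') D k"
    and ys: "length ys' = length ys" "distinct ys'" "k \<notin> set ys'" "ys \<noteq> []"
      "insert k (set ys') \<inter> \<sigma> ` (fv_decl D - set ys) = {}"
  shows "cps_repv (Lam (ys' @ [k]) D') \<sigma> (Lam ys D)"
  unfolding cps_repv_def
proof (intro conjI allI)
  show "wf_val True (Lam (ys' @ [k]) D')" using ys rep_wf(2)[OF D'] by auto
  fix q \<rho>
  let ?n = "q + length ys" let ?zs = "[q..<?n]"
  let ?U = "updl (\<rho>(k := ?n)) ys' ?zs"
  \<comment> \<open>The last parameter \<open>k\<close> is split off: it takes the level after those
    of \<open>ys'\<close> and moves into the base renaming.\<close>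
  have U: "updl \<rho> (ys' @ [k]) [q..<Suc ?n] = ?U"
    using ys(1) by (simp add: updl_append)
  have Uk: "?U k = ?n" using ys(3) by (simp add: updl_notin)
  have "ccps_decl (Suc ?n) (?U \<circ> updl \<sigma> ys ys') D ?n = ccps_decl (Suc ?n) (updl (\<rho> \<circ> \<sigma>) ys ?zs) D ?n"
  proof (rule ccps_cong)
    fix v assume v: "v \<in> fv_decl D"
    have "?U (updl \<sigma> ys ys' v) = updl (\<rho>(k := ?n) \<circ> \<sigma>) ys ?zs v"
      by (rule updl_updl) (use v ys in auto)
    also have "\<dots> = updl (\<rho> \<circ> \<sigma>) ys ?zs v"
      by (rule updl_cong) (use v ys in auto)
    finally show "(?U \<circ> updl \<sigma> ys ys') v = updl (\<rho> \<circ> \<sigma>) ys ?zs v" by simp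
  qed
  moreover have "canon_decl (Suc ?n) ?U D' = ccps_decl (Suc ?n) (?U \<circ> updl \<sigma> ys ys') D (?U k)"
    using D' unfolding cps_rep_def by blast
  moreover have "q + length (ys' @ [k]) = Suc ?n" using ys(1) by simp
  ultimately show "canon_val q \<rho> (Lam (ys' @ [k]) D') = ccps_val q (\<rho> \<circ> \<sigma>) (Lam ys D)"
    by (simp only: canon_val.simps ccps_val.simps Uk U)
qed

text \<open>The body \<open>T\<close> is returned with its own representation because contracting
  the procedure needs it. Existence of representatives of \<open>D\<close> is a hypothesis so that
  the lemma can be used inside the induction for \<open>ex_rep\<close>.\<close>

lemma ex_rep_Lam:
  assumes IH: "\<And>\<sigma> c. \<exists>T. cps_rep T \<sigma> D c" and fin: "finite S" and ys: "ys \<noteq> []"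
  shows "\<exists>ys' k T. cps_repv (Lam (ys' @ [k]) T) \<sigma> (Lam ys D) \<and> cps_rep T (updl \<sigma> ys ys') D k
    \<and> length ys' = length ys \<and> distinct (ys' @ [k]) \<and> set (ys' @ [k]) \<inter> S = {}"
proof -
  let ?S = "S \<union> \<sigma> ` fv_decl D"
  obtain ys' where ys': "length ys' = length ys" "distinct ys'" "set ys' \<inter> ?S = {}"
    using ex_fresh_list[of ?S "length ys"] fin by auto
  obtain k where k: "k \<notin> ?S \<union> set ys'" using ex_fresh_var[of "?S \<union> set ys'"] fin by auto
  obtain T where T: "cps_rep T (updl \<sigma> ys ys') D k" using IH by blast
  have "cps_repv (Lam (ys' @ [k]) T) \<sigma> (Lam ys D)"
    by (rule repv_Lam[OF T]) (use ys ys' k in auto)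
  then show ?thesis using T ys' k by (intro exI[of _ ys'] exI[of _ k] exI[of _ T]) auto
qed

lemma ex_rep:
  "wf_val False V \<Longrightarrow> \<exists>U. cps_repv U \<sigma> V"
  "wf_decl False D \<Longrightarrow> \<exists>T. cps_rep T \<sigma> D c"
proof (induction V and D arbitrary: \<sigma> and \<sigma> c rule: val.induct decl.induct)
  case Star
  then show ?case using repv_Star by blast
next
  case (Lam ys D)
  then show ?case using ex_rep_Lam[of D "{}" ys \<sigma>] by auto
next
  case (Let x V D)
  obtain x' where x': "x' \<notin> insert c (\<sigma> ` fv_decl D)"
    using ex_fresh_var[of "insert c (\<sigma> ` fv_decl D)"] by auto
  obtain V' where "cps_repv V' \<sigma> V" using Let by fastforce
  moreover obtain D' where "cps_rep D' (\<sigma>(x := x')) D c" using Let by fastforce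
  ultimately have "cps_rep (Let x' V' D') \<sigma> (Let x V D) c" by (rule rep_Let) (use x' in auto)
  then show ?case by blast
next
  case (Tm M)
  then show ?case using rep_Tm[of M \<sigma> c] by auto
qed

text \<open>Links the named translation to the relation. \<open>k\<close> has to avoid the bound
  names too, since \<open>cps_decl\<close> keeps them and they would capture it.\<close>

lemma rep_cps:
  "wf_val False V \<Longrightarrow> cps_repv (cps_val V) id V"
  "wf_decl False D \<Longrightarrow> k \<notin> av_decl D \<Longrightarrow> cps_rep (cps_decl D k) id D k"
proof (induction V and D arbitrary: and k rule: val.induct decl.induct)
  case Star
  then show ?case using repv_Star by simp
next
  case (Lam ys D)
  let ?k = "fresh (set ys \<union> av_decl D)"
  have k: "v < ?k" if "v \<in> set ys \<union> av_decl D" for v by (rule fresh_gt) (use that in auto)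
  have k': "?k \<notin> set ys" "?k \<notin> av_decl D" using k by blast+
  have "cps_repv (Lam (ys @ [?k]) (cps_decl D ?k)) id (Lam ys D)"
  proof (rule repv_Lam)
    have "cps_rep (cps_decl D ?k) id D ?k" by (rule Lam.IH[OF _ k'(2)]) (use Lam.prems in simp)
    then show "cps_rep (cps_decl D ?k) (updl id ys ys) D ?k" by (rule rep_cong) (simp add: updl_id)
  qed (use Lam.prems k' fv_subset_av(2)[of D] in auto)
  then show ?case by (simp only: cps_val.simps Let_def)
next
  case (Let x V D)
  have "cps_rep (Let x (cps_val V) (cps_decl D k)) id (Let x V D) k"
  proof (rule rep_Let)
    have "cps_rep (cps_decl D k) id D k" by (rule Let.IH(2)) (use Let.prems in auto)
    then show "cps_rep (cps_decl D k) (id(x := x)) D k" by (rule rep_cong) simp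
    show "cps_repv (cps_val V) id V" by (rule Let.IH(1)) (use Let.prems in auto)
  qed (use Let.prems in auto)
  then show ?case by (simp only: cps_decl.simps)
next
  case (Tm M)
  then have "cps_rep (cps_tm (subst_tm id M) k) id (Tm M) k" by (intro rep_Tm) simp
  then show ?case by (simp only: cps_decl.simps subst_tm_id)
qed

text \<open>Each rule is mirrored by giving both sides the same fresh target binders. The alpha
  rules vanish, as one representative serves both sides; for transitivity the two representatives of
  the middle term are joined by \<open>rep_unique\<close>; the side conditions of
  \<open>swap\<close> and \<open>gc\<close> carry over by \<open>repv_fv\<close> and
  \<open>rep_fv\<close>.\<close>

lemma eqv_cps:
  "eqv_val False V V' \<Longrightarrow> \<exists>U U'. cps_repv U \<sigma> V \<and> cps_repv U' \<sigma> V' \<and> eqv_val True U U'"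
  "eqv_decl False D D' \<Longrightarrow> \<exists>T T'. cps_rep T \<sigma> D c \<and> cps_rep T' \<sigma> D' c \<and> eqv_decl True T T'"
proof (induction arbitrary: \<sigma> and \<sigma> c rule: eqv_val_eqv_decl.inducts)
  case (refl_v V)
  then obtain U where "cps_repv U \<sigma> V" using ex_rep(1) by blast
  then show ?case using rep_wf refl_v by (meson eqv_val_eqv_decl.refl_v)
next
  case (sym_v V V')
  then show ?case by (meson eqv_val_eqv_decl.sym_v)
next
  case (trans_v V1 V2 V3)
  obtain U1 U2 where 1: "cps_repv U1 \<sigma> V1" "cps_repv U2 \<sigma> V2" "eqv_val True U1 U2" using trans_v.IH(2) by blast
  obtain U2' U3 where 2: "cps_repv U2' \<sigma> V2" "cps_repv U3 \<sigma> V3" "eqv_val True U2' U3" using trans_v.IH(4) by blast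
  have "eqv_val True U1 U3" by (meson 1 2 rep_unique(1) eqv_val_eqv_decl.trans_v)
  then show ?case using 1 2 by blast
next
  case (refl_d D)
  then obtain T where "cps_rep T \<sigma> D c" using ex_rep(2) by blast
  then show ?case using rep_wf by (meson eqv_val_eqv_decl.refl_d)
next
  case (sym_d D D')
  then show ?case by (meson eqv_val_eqv_decl.sym_d)
next
  case (trans_d D1 D2 D3)
  obtain U1 U2 where 1: "cps_rep U1 \<sigma> D1 c" "cps_rep U2 \<sigma> D2 c" "eqv_decl True U1 U2" using trans_d.IH(2) by blast
  obtain U2' U3 where 2: "cps_rep U2' \<sigma> D2 c" "cps_rep U3 \<sigma> D3 c" "eqv_decl True U2' U3" using trans_d.IH(4) by blast
  have "eqv_decl True U1 U3" by (meson 1 2 rep_unique(2) eqv_val_eqv_decl.trans_d)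
  then show ?case using 1 2 by blast
next
  case (lam_cong D D' ys)
  let ?S = "\<sigma> ` fv_decl D \<union> \<sigma> ` fv_decl D'"
  obtain ys' where ys': "length ys' = length ys" "distinct ys'" "set ys' \<inter> ?S = {}"
    using ex_fresh_list[of ?S "length ys"] by auto
  obtain k where k: "k \<notin> ?S \<union> set ys'" using ex_fresh_var[of "?S \<union> set ys'"] by auto
  obtain T T' where T: "cps_rep T (updl \<sigma> ys ys') D k" "cps_rep T' (updl \<sigma> ys ys') D' k" "eqv_decl True T T'"
    using lam_cong.IH(2) by blast
  have "cps_repv (Lam (ys' @ [k]) T) \<sigma> (Lam ys D)" "cps_repv (Lam (ys' @ [k]) T') \<sigma> (Lam ys D')"
    by (rule repv_Lam[OF T(1)] repv_Lam[OF T(2)]; use lam_cong ys' k in auto)+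
  moreover have "eqv_val True (Lam (ys' @ [k]) T) (Lam (ys' @ [k]) T')"
    by (rule eqv_val_eqv_decl.lam_cong[OF T(3)]) (use ys' k in auto)
  ultimately show ?case by blast
next
  case (let_cong V V' D D' x)
  let ?S = "insert c (\<sigma> ` fv_decl D \<union> \<sigma> ` fv_decl D')"
  obtain x' where x': "x' \<notin> ?S" using ex_fresh_var[of ?S] by auto
  obtain U U' where U: "cps_repv U \<sigma> V" "cps_repv U' \<sigma> V'" "eqv_val True U U'" using let_cong.IH(2) by blast
  obtain T T' where T: "cps_rep T (\<sigma>(x := x')) D c" "cps_rep T' (\<sigma>(x := x')) D' c" "eqv_decl True T T'"
    using let_cong.IH(4) by blast
  have "cps_rep (Let x' U T) \<sigma> (Let x V D) c" "cps_rep (Let x' U' T') \<sigma> (Let x V' D') c"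
    by (rule rep_Let[OF U(1) T(1)] rep_Let[OF U(2) T(2)]; use x' in auto)+
  then show ?case using eqv_val_eqv_decl.let_cong[OF U(3) T(3)] by blast
next
  case (alpha_let x V D y)
  obtain U where U: "cps_repv U \<sigma> V" using ex_rep(1) alpha_let by fastforce
  let ?S = "insert c (\<sigma> ` fv_decl D \<union> \<sigma> ` fv_decl (subst_decl (id(x := y)) D))"
  obtain x' where x': "x' \<notin> ?S" using ex_fresh_var[of ?S] by auto
  obtain T where T: "cps_rep T (\<sigma>(x := x')) D c" using ex_rep(2) alpha_let by fastforce
  have "cps_rep T (\<sigma>(y := x') \<circ> id(x := y)) D c"
    using T by (rule rep_cong) (use alpha_let fv_subset_av(2)[of D] in auto)
  moreover have "nocap (id(x := y)) (fv_decl D) (bnd_decl D)"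
    using alpha_let bnd_subset_av(2)[of D] by (auto simp: nocap_def)
  ultimately have T': "cps_rep T (\<sigma>(y := x')) (subst_decl (id(x := y)) D) c"
    by (simp only: rep_subst)
  have "cps_rep (Let x' U T) \<sigma> (Let x V D) c" "cps_rep (Let x' U T) \<sigma> (Let y V (subst_decl (id(x := y)) D)) c"
    by (rule rep_Let[OF U T] rep_Let[OF U T']; use x' in auto)+
  then show ?case by (meson rep_wf(2) eqv_val_eqv_decl.refl_d)
next
  case (alpha_lam ys D zs)
  have wf: "wf_decl False D" "ys \<noteq> []" "distinct ys" using alpha_lam by auto
  let ?D = "subst_decl (mk_sub ys zs) D"
  let ?S = "\<sigma> ` fv_decl D \<union> \<sigma> ` fv_decl ?D"
  obtain ys' where ys': "length ys' = length ys" "distinct ys'" "set ys' \<inter> ?S = {}"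
    using ex_fresh_list[of ?S "length ys"] by auto
  obtain k where k: "k \<notin> ?S \<union> set ys'" using ex_fresh_var[of "?S \<union> set ys'"] by auto
  obtain T where T: "cps_rep T (updl \<sigma> ys ys') D k" using ex_rep(2) wf by blast
  have "cps_rep T (updl \<sigma> zs ys' \<circ> updl id ys zs) D k"
    using T
  proof (rule rep_cong)
    fix v assume "v \<in> fv_decl D"
    then have "updl \<sigma> zs ys' (updl id ys zs v) = updl (\<sigma> \<circ> id) ys ys' v"
      by (intro updl_updl) (use alpha_lam ys' fv_subset_av(2)[of D] in auto)
    then show "updl \<sigma> ys ys' v = (updl \<sigma> zs ys' \<circ> updl id ys zs) v" by simp
  qed
  moreover have "nocap (mk_sub ys zs) (fv_decl D) (bnd_decl D)"
    unfolding nocap_def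
  proof
    fix v
    show "mk_sub ys zs v = v \<or> mk_sub ys zs v \<notin> set (bnd_decl D)"
      using alpha_lam(2,4) bnd_subset_av(2)[of D] updl_in[of v ys zs id] updl_notin[of v ys id zs]
      by (auto simp: mk_sub_updl)
  qed
  ultimately have T': "cps_rep T (updl \<sigma> zs ys') ?D k"
    by (simp only: rep_subst mk_sub_updl)
  have "cps_repv (Lam (ys' @ [k]) T) \<sigma> (Lam ys D)"
    by (rule repv_Lam[OF T]) (use wf ys' k in auto)
  moreover have "cps_repv (Lam (ys' @ [k]) T) \<sigma> (Lam zs ?D)"
    by (rule repv_Lam[OF T']) (use wf alpha_lam ys' k in auto)
  ultimately show ?case by (meson rep_wf(1) eqv_val_eqv_decl.refl_v)
next
  case (swap x1 V1 x2 V2 D)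
  let ?S = "insert c (\<sigma> ` (fv_decl D \<union> fv_val V1 \<union> fv_val V2))"
  obtain y1 where y1: "y1 \<notin> ?S" using ex_fresh_var[of ?S] by auto
  obtain y2 where y2: "y2 \<notin> insert y1 ?S" using ex_fresh_var[of "insert y1 ?S"] by auto
  obtain U1 where U1: "cps_repv U1 \<sigma> V1" using ex_rep(1) swap by fastforce
  obtain U2 where U2: "cps_repv U2 \<sigma> V2" using ex_rep(1) swap by fastforce
  obtain T where T: "cps_rep T (\<sigma>(x1 := y1, x2 := y2)) D c" using ex_rep(2) swap by fastforce
  have U1': "cps_repv U1 (\<sigma>(x2 := y2)) V1" using U1 by (rule repv_cong) (use swap in auto)
  have U2': "cps_repv U2 (\<sigma>(x1 := y1)) V2" using U2 by (rule repv_cong) (use swap in auto)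
  have T': "cps_rep T (\<sigma>(x2 := y2, x1 := y1)) D c" using T swap(2) by (simp add: fun_upd_twist)
  have "cps_rep (Let y1 U1 (Let y2 U2 T)) \<sigma> (Let x1 V1 (Let x2 V2 D)) c"
    by (intro rep_Let U1 U2' T) (use y1 y2 in auto)
  moreover have "cps_rep (Let y2 U2 (Let y1 U1 T)) \<sigma> (Let x2 V2 (Let x1 V1 D)) c"
    by (intro rep_Let U2 U1' T') (use y1 y2 in auto)
  moreover have "eqv_decl True (Let y1 U1 (Let y2 U2 T)) (Let y2 U2 (Let y1 U1 T))"
    by (rule eqv_val_eqv_decl.swap)
      (use y1 y2 repv_fv[OF U1] repv_fv[OF U2] rep_wf(1)[OF U1] rep_wf(1)[OF U2] rep_wf(2)[OF T] in auto)
  ultimately show ?case by blast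
next
  case (gc x V D)
  let ?S = "insert c (\<sigma> ` (fv_decl D \<union> fv_val V))"
  obtain y where y: "y \<notin> ?S" using ex_fresh_var[of ?S] by auto
  obtain U where U: "cps_repv U \<sigma> V" using ex_rep(1) gc by fastforce
  obtain T where T: "cps_rep T \<sigma> D c" using ex_rep(2) gc by fastforce
  have T': "cps_rep T (\<sigma>(x := y)) D c" using T by (rule rep_cong) (use gc in auto)
  have "cps_rep (Let y U T) \<sigma> (Let x V D) c" by (rule rep_Let[OF U T']) (use y in auto)
  moreover have "eqv_decl True (Let y U T) T"
    by (rule eqv_val_eqv_decl.gc) (use y rep_fv[OF T] rep_wf(1)[OF U] rep_wf(2)[OF T] in auto)
  ultimately show ?case using T by blast
qed

section \<open>Evaluation contexts as continuation chains\<close>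

lemma lets_mono:
  "fv_decl (lets L D') \<subseteq> fv_decl (lets L D) \<union> (fv_decl D' - fst ` set L)"
proof (induction L)
  case (Cons p L)
  then show ?case by (cases p) force
qed simp

text \<open>Translation of a \<open>let\<close> prefix without its body: \<open>A\<close> is the
  target prefix for \<open>L\<close>, and \<open>\<sigma>'\<close> the renaming in force below it.
  Redex and contractum share their prefixes, which are thus translated once and filled
  twice.\<close>

inductive spine :: "(var \<Rightarrow> var) \<Rightarrow> (var \<times> val) list \<Rightarrow> (var \<times> val) list \<Rightarrow> (var \<Rightarrow> var) \<Rightarrow> bool" where
  spine_Nil: "spine \<sigma> [] [] \<sigma>"
| spine_Cons: "cps_repv V' \<sigma> V \<Longrightarrow> spine (\<sigma>(y := y')) A L \<sigma>' \<Longrightarrow> spine \<sigma> ((y', V') # A) ((y, V) # L) \<sigma>'"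

lemma spine_rep:
  "spine \<sigma> A L \<sigma>' \<Longrightarrow> cps_rep T \<sigma>' D c \<Longrightarrow> distinct (map fst A) \<Longrightarrow>
   fst ` set A \<inter> insert c (\<sigma> ` fv_decl (lets L D)) = {} \<Longrightarrow> cps_rep (lets A T) \<sigma> (lets L D) c"
proof (induction rule: spine.induct)
  case (spine_Cons V' \<sigma> V y y' A L \<sigma>')
  have "cps_rep (lets A T) (\<sigma>(y := y')) (lets L D) c"
    by (rule spine_Cons.IH) (use spine_Cons.prems in auto)
  then show ?case unfolding lets_simps
    by (rule rep_Let[OF spine_Cons.hyps(1)]) (use spine_Cons.prems in auto)
qed simp

lemma ex_spine:
  "\<forall>(x, V)\<in>set L. wf_val False V \<Longrightarrow> finite S \<Longrightarrow>
   \<exists>A \<sigma>'. spine \<sigma> A L \<sigma>' \<and> distinct (map fst A) \<and> fst ` set A \<inter> S = {}"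
proof (induction L arbitrary: \<sigma> S)
  case Nil
  then show ?case by (intro exI[of _ "[]"] exI[of _ \<sigma>]) (auto intro: spine_Nil)
next
  case (Cons yV L)
  obtain y V where yV: "yV = (y, V)" by force
  obtain y' where y': "y' \<notin> S" using ex_fresh_var Cons.prems by blast
  obtain A \<sigma>' where A: "spine (\<sigma>(y := y')) A L \<sigma>'" "distinct (map fst A)" "fst ` set A \<inter> insert y' S = {}"
    using Cons.IH[of "insert y' S" "\<sigma>(y := y')"] Cons.prems by (meson finite_insert list.set_intros(2))
  obtain V' where "cps_repv V' \<sigma> V" using ex_rep(1)[of V \<sigma>] Cons.prems yV by auto
  then have "spine \<sigma> ((y', V') # A) (yV # L) \<sigma>'" using A(1) yV by (auto intro: spine_Cons)
  then show ?case using A y' by (intro exI[of _ "(y', V') # A"] exI[of _ \<sigma>']) auto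
qed

lemma spine_wf: "spine \<sigma> A L \<sigma>' \<Longrightarrow> \<forall>(x, V)\<in>set A. wf_val True V"
  by (induction rule: spine.induct) (auto dest: rep_wf)

lemma spine_notin: "spine \<sigma> A L \<sigma>' \<Longrightarrow> v \<notin> fst ` set L \<Longrightarrow> \<sigma>' v = \<sigma> v"
  by (induction rule: spine.induct) auto

lemma spine_length: "spine \<sigma> A L \<sigma>' \<Longrightarrow> length A = length L"
  by (induction rule: spine.induct) auto

section \<open>Frames and their continuations\<close>

definition is_App :: "tm \<Rightarrow> bool" where
  "is_App N \<longleftrightarrow> (\<exists>M Ms. N = App M Ms)"

fun fv_frame :: "frame \<Rightarrow> var set" where
  "fv_frame (xs, Ms) = set xs \<union> \<Union> (set (map fv_tm Ms))"

lemma finite_fv_frame [simp]: "finite (fv_frame f)"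
  by (cases f) auto

lemma fv_plugF [simp]: "fv_tm (plugF f N) = fv_frame f \<union> fv_tm N"
proof (cases f)
  case (Pair xs Ms)
  then show ?thesis by (cases xs) auto
qed

definition fv_frames :: "frame list \<Rightarrow> var set" where
  "fv_frames Cs = \<Union> (fv_frame ` set Cs)"

lemma fv_frames_simps [simp]:
  "fv_frames [] = {}" "fv_frames (f # Cs) = fv_frame f \<union> fv_frames Cs"
  "fv_frames (Cs @ Cs') = fv_frames Cs \<union> fv_frames Cs'" "finite (fv_frames Cs)"
  by (auto simp: fv_frames_def)

lemma fv_plugC [simp]: "fv_tm (plugC Cs N) = fv_frames Cs \<union> fv_tm N"
  by (induction Cs) (auto simp del: fv_frame.simps plugF.simps)

lemma plugC_append: "plugC (Cs @ Cs') N = plugC Cs (plugC Cs' N)"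
  by (induction Cs) auto

lemma is_App_plugF [simp]: "is_App (plugF f N)"
  by (cases f) (auto simp: is_App_def)

lemma wf_plugF: "wf_tm (plugF (xs, Ms) N) \<Longrightarrow> (\<forall>M\<in>set Ms. wf_tm M) \<and> wf_tm N"
  by (cases xs) (auto simp: list_all_iff)

lemma wf_plugC: "wf_tm (plugC Cs N) \<Longrightarrow> (\<forall>(xs, Ms)\<in>set Cs. \<forall>M\<in>set Ms. wf_tm M) \<and> wf_tm N"
  by (induction Cs) (auto simp del: plugF.simps dest: wf_plugF)

lemma subst_plugF: "subst_tm \<sigma> (plugF (xs, Ms) N) = plugF (map \<sigma> xs, map (subst_tm \<sigma>) Ms) (subst_tm \<sigma> N)"
  by (cases xs) auto

lemma ccps_list_Vars: "ccps_list n vs (map Var xs @ ts) k = ccps_list n (vs @ xs) ts k"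
  by (induction xs arbitrary: vs) auto

lemma cps_list_Vars: "cps_list vs (map Var xs @ ts) k = cps_list (vs @ xs) ts k"
  by (induction xs arbitrary: vs) auto

text \<open>\<open>ccps_list\<close> treats the head like any argument, so the two shapes of
  \<open>plugF\<close>, with the hole in head or in argument position, become one.\<close>

lemma ccps_tm_plugF: "ccps_tm n (plugF (xs, Ms) N) k = ccps_list n xs (N # Ms) k"
  by (cases xs) (auto simp: ccps_list_Vars)

text \<open>\<open>\<lambda>y. B\<close> is the continuation to which a frame is translated.\<close>
definition frame_rep :: "var \<Rightarrow> decl \<Rightarrow> (var \<Rightarrow> var) \<Rightarrow> frame \<Rightarrow> var \<Rightarrow> bool" where
  "frame_rep y B \<tau> f k \<longleftrightarrow> wf_decl True B \<and> y \<notin> insert k (\<tau> ` fv_frame f)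
     \<and> (\<forall>q \<rho>. canon_decl q \<rho> B =
          ccps_list q (map (\<rho> \<circ> \<tau>) (fst f) @ [\<rho> y]) (map (subst_tm (\<rho> \<circ> \<tau>)) (snd f)) (\<rho> k))"

lemma ex_frame_rep:
  assumes "\<forall>M\<in>set (snd f). wf_tm M"
  shows "\<exists>y B. frame_rep y B \<tau> f k"
proof -
  obtain xs Ms where f: "f = (xs, Ms)" by force
  obtain y where y: "y \<notin> insert k (\<tau> ` fv_frame f)" using ex_fresh_var[of "insert k (\<tau> ` fv_frame f)"] by auto
  have "frame_rep y (cps_list (map \<tau> xs @ [y]) (map (subst_tm \<tau>) Ms) k) \<tau> f k"
    unfolding frame_rep_def
  proof (intro conjI allI)
    show "wf_decl True (cps_list (map \<tau> xs @ [y]) (map (subst_tm \<tau>) Ms) k)"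
      by (rule wf_cps_list) (use assms f in \<open>auto simp: list_all_iff\<close>)
    show "canon_decl q \<rho> (cps_list (map \<tau> xs @ [y]) (map (subst_tm \<tau>) Ms) k)
      = ccps_list q (map (\<rho> \<circ> \<tau>) (fst f) @ [\<rho> y]) (map (subst_tm (\<rho> \<circ> \<tau>)) (snd f)) (\<rho> k)" for q \<rho>
      by (simp add: canon_cps_list f subst_tm_comp comp_def)
  qed (rule y)
  then show ?thesis by blast
qed

text \<open>An application in the hole is what triggers the binding of \<open>k'\<close>; a variable
  there would join the processed variables and create no continuation. Hence
  \<open>is_App N\<close>.\<close>

lemma frame_rep_plug:
  assumes B: "frame_rep y B \<tau> f k" and T: "cps_rep T \<tau> (Tm N) k'" and N: "is_App N"
    and k': "k' \<notin> insert k (\<tau> ` fv_tm (plugF f N))"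
  shows "cps_rep (Let k' (Lam [y] B) T) \<tau> (Tm (plugF f N)) k"
  unfolding cps_rep_def
proof (intro conjI allI)
  show "wf_decl True (Let k' (Lam [y] B) T)" using B rep_wf(2)[OF T] by (simp add: frame_rep_def)
  fix q and \<rho> :: "var \<Rightarrow> var"
  obtain xs Ms where f: "f = (xs, Ms)" by force
  obtain M Ns where N': "N = App M Ns" using N by (auto simp: is_App_def)
  have y: "y \<noteq> k" "\<And>v. v \<in> fv_frame f \<Longrightarrow> \<tau> v \<noteq> y" using B by (auto simp: frame_rep_def)
  have xs: "map (\<rho>(y := q) \<circ> \<tau>) xs = map (\<rho> \<circ> \<tau>) xs" using y f by auto
  have Ms: "map (subst_tm (\<rho>(y := q) \<circ> \<tau>)) Ms = map (subst_tm (\<rho> \<circ> \<tau>)) Ms"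
  proof (rule map_cong[OF refl], rule subst_tm_cong)
    fix M v assume "M \<in> set Ms" "v \<in> fv_tm M"
    then have "v \<in> fv_frame f" using f by auto
    then show "(\<rho>(y := q) \<circ> \<tau>) v = (\<rho> \<circ> \<tau>) v" using y(2) by simp
  qed
  have "canon_decl (Suc q) (\<rho>(y := q)) B
    = ccps_list (Suc q) (map (\<rho>(y := q) \<circ> \<tau>) xs @ [(\<rho>(y := q)) y]) (map (subst_tm (\<rho>(y := q) \<circ> \<tau>)) Ms) ((\<rho>(y := q)) k)"
    using B unfolding frame_rep_def f fst_conv snd_conv by blast
  then have 1: "canon_decl (Suc q) (\<rho>(y := q)) B = ccps_list (Suc q) (map (\<rho> \<circ> \<tau>) xs @ [q]) (map (subst_tm (\<rho> \<circ> \<tau>)) Ms) (\<rho> k)"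
    unfolding xs Ms using y(1) by simp
  have "subst_tm (\<rho>(k' := q) \<circ> \<tau>) N = subst_tm (\<rho> \<circ> \<tau>) N"
    by (rule subst_tm_cong) (use k' in auto)
  moreover have "canon_decl (Suc q) (\<rho>(k' := q)) T = ccps_decl (Suc q) (\<rho>(k' := q) \<circ> \<tau>) (Tm N) ((\<rho>(k' := q)) k')"
    using T unfolding cps_rep_def by blast
  ultimately have 2: "canon_decl (Suc q) (\<rho>(k' := q)) T = ccps_tm (Suc q) (subst_tm (\<rho> \<circ> \<tau>) N) q"
    by simp
  show "canon_decl q \<rho> (Let k' (Lam [y] B) T) = ccps_decl q (\<rho> \<circ> \<tau>) (Tm (plugF f N)) (\<rho> k)"
    unfolding f ccps_decl.simps subst_plugF ccps_tm_plugF
    using 1 2 by (simp add: N')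
qed

declare fv_frame.simps [simp del]

text \<open>The bindings by which the translation names the continuations of the frames of a context,
  outermost first; \<open>k\<close> is the innermost one, and is \<open>c\<close> if there are no frames.\<close>
inductive chain :: "(var \<Rightarrow> var) \<Rightarrow> (var \<times> val) list \<Rightarrow> frame list \<Rightarrow> var \<Rightarrow> var \<Rightarrow> bool"
  for \<tau> :: "var \<Rightarrow> var" where
  chain_Nil: "chain \<tau> [] [] c c"
| chain_snoc: "chain \<tau> A Cs c k \<Longrightarrow> frame_rep y B \<tau> f k
    \<Longrightarrow> chain \<tau> (A @ [(k', Lam [y] B)]) (Cs @ [f]) c k'"

lemma chain_cong:
  "chain \<tau> A Cs c k \<Longrightarrow> \<forall>v\<in>fv_frames Cs. \<tau> v = \<tau>' v \<Longrightarrow> chain \<tau>' A Cs c k"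
proof (induction rule: chain.induct)
  case (chain_Nil c)
  show ?case by (rule chain.chain_Nil)
next
  case (chain_snoc A Cs c k y B f k')
  have eq: "\<tau> v = \<tau>' v" if "v \<in> fv_frame f" for v using chain_snoc.prems that by auto
  obtain xs Ms where f: "f = (xs, Ms)" by force
  have "\<tau> ` fv_frame f = \<tau>' ` fv_frame f" using eq by (intro image_cong) auto
  moreover have "map (\<rho> \<circ> \<tau>) (fst f) = map (\<rho> \<circ> \<tau>') (fst f)" for \<rho> :: "var \<Rightarrow> var"
    using eq f by (auto simp: fv_frame.simps)
  moreover have "map (subst_tm (\<rho> \<circ> \<tau>)) (snd f) = map (subst_tm (\<rho> \<circ> \<tau>')) (snd f)" for \<rho>
  proof (rule map_cong[OF refl], rule subst_tm_cong)
    fix M v assume "M \<in> set (snd f)" "v \<in> fv_tm M"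
    then have "v \<in> fv_frame f" using f by (auto simp: fv_frame.simps)
    then show "(\<rho> \<circ> \<tau>) v = (\<rho> \<circ> \<tau>') v" using eq by simp
  qed
  ultimately have "frame_rep y B \<tau>' f k" using chain_snoc.hyps(2) by (simp only: frame_rep_def simp_thms)
  then show ?case using chain_snoc by (intro chain.chain_snoc) auto
qed

lemma chain_last: "chain \<tau> A Cs c k \<Longrightarrow> k = c \<or> k \<in> fst ` set A"
  by (induction rule: chain.induct) auto

lemma chain_wf: "chain \<tau> A Cs c k \<Longrightarrow> \<forall>(x, V)\<in>set A. wf_val True V"
  by (induction rule: chain.induct) (auto simp: frame_rep_def)

text \<open>Frames are added at the inner end, because the continuation of a frame mentions that of
  the frame around it.\<close>

lemma ex_chain:
  "\<forall>(xs, Ms)\<in>set Cs. \<forall>M\<in>set Ms. wf_tm M \<Longrightarrow> finite S \<Longrightarrow>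
   \<exists>A k. chain \<tau> A Cs c k \<and> distinct (map fst A) \<and> fst ` set A \<inter> S = {}"
proof (induction Cs rule: rev_induct)
  case Nil
  show ?case by (intro exI[of _ "[]"] exI[of _ c]) (auto intro: chain_Nil)
next
  case (snoc f Cs)
  obtain A k where A: "chain \<tau> A Cs c k" "distinct (map fst A)" "fst ` set A \<inter> S = {}"
    using snoc by auto
  obtain y B where B: "frame_rep y B \<tau> f k" using ex_frame_rep[of f \<tau> k] snoc.prems by auto
  obtain k' where k': "k' \<notin> S \<union> fst ` set A" using ex_fresh_var[of "S \<union> fst ` set A"] snoc.prems by auto
  show ?case
    using chain_snoc[OF A(1) B, of k'] A k' by (intro exI[of _ "A @ [(k', Lam [y] B)]"] exI[of _ k']) auto
qed

text \<open>Every \<open>plugF\<close> is an application, so the condition of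
  \<open>frame_rep_plug\<close> only has to be imposed on the term in the innermost hole.\<close>

lemma chain_rep:
  "chain \<tau> A Cs c k \<Longrightarrow> cps_rep T \<tau> (Tm N) k \<Longrightarrow> Cs = [] \<or> is_App N \<Longrightarrow> distinct (map fst A) \<Longrightarrow>
   fst ` set A \<inter> insert c (\<tau> ` fv_tm (plugC Cs N)) = {} \<Longrightarrow> cps_rep (lets A T) \<tau> (Tm (plugC Cs N)) c"
proof (induction arbitrary: T N rule: chain.induct)
  case (chain_snoc A Cs c k y B f k')
  have "k' \<noteq> k" using chain_last[OF chain_snoc.hyps(1)] chain_snoc.prems(3,4) by auto
  then have "cps_rep (Let k' (Lam [y] B) T) \<tau> (Tm (plugF f N)) k"
    by (intro frame_rep_plug) (use chain_snoc.hyps chain_snoc.prems in auto)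
  then have "cps_rep (lets A (Let k' (Lam [y] B) T)) \<tau> (Tm (plugC Cs (plugF f N))) c"
    by (rule chain_snoc.IH) (use chain_snoc.prems in auto)
  then show ?case by (simp add: plugC_append)
qed simp

lemma swap_lets:
  "\<forall>(k, W)\<in>set A. wf_val ak W \<and> y \<notin> fv_val W \<and> k \<noteq> y \<and> k \<notin> fv_val V \<Longrightarrow> wf_val ak V \<Longrightarrow> wf_decl ak D \<Longrightarrow>
   eqv_decl ak (lets A (Let y V D)) (Let y V (lets A D))"
proof (induction A)
  case Nil
  then show ?case by (auto intro: refl_d)
next
  case (Cons kW A)
  obtain k W where kW: "kW = (k, W)" by force
  have "eqv_decl ak (Let k W (lets A (Let y V D))) (Let k W (Let y V (lets A D)))"
    by (rule let_cong[OF refl_v Cons.IH]) (use Cons.prems kW in auto)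
  moreover have "eqv_decl ak (Let k W (Let y V (lets A D))) (Let y V (Let k W (lets A D)))"
    by (rule swap) (use Cons.prems kW in auto)
  ultimately show ?case unfolding kW lets_simps by (rule trans_d)
qed

text \<open>Contracting a redex leaves the bindings \<open>L\<close> of the procedure body inside the continuation
  bindings \<open>A\<close>, whereas in the source they were moved in front of the context.\<close>
lemma chain_comm:
  "chain \<tau> A Cs c k \<Longrightarrow> wf_decl False (lets L (Tm N)) \<Longrightarrow> Cs = [] \<or> is_App N \<Longrightarrow>
   distinct (map fst A) \<Longrightarrow>
   fst ` set A \<inter> insert c (\<tau> ` fv_decl (lets L (Tm N)) \<union> \<tau> ` fv_frames Cs) = {} \<Longrightarrow>
   fst ` set L \<inter> fv_frames Cs = {} \<Longrightarrow> cps_rep T \<tau> (lets L (Tm N)) k \<Longrightarrow>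
   \<exists>T'. cps_rep T' \<tau> (lets L (Tm (plugC Cs N))) c \<and> eqv_decl True (lets A T) T'"
proof (induction L arbitrary: \<tau> T)
  case Nil
  have "cps_rep (lets A T) \<tau> (Tm (plugC Cs N)) c"
    by (rule chain_rep) (use Nil in auto)
  then show ?case unfolding lets_simps using rep_wf(2) refl_d by blast
next
  case (Cons xV L)
  obtain x V where xV: "xV = (x, V)" by force
  let ?S = "insert k (insert c (fst ` set A \<union> \<Union> ((fv_val \<circ> snd) ` set A)
     \<union> \<tau> ` (fv_decl (lets L (Tm N)) \<union> fv_decl (lets L (Tm (plugC Cs N))))))"
  have "finite ?S" by simp
  \<comment> \<open>\<open>y\<close> also avoids the names and values of the chain, so that its
    binding can be swapped outwards past \<open>A\<close>.\<close>
  from ex_fresh_var[OF this] obtain y where "y \<notin> ?S" by (elim exE)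
  then have y: "y \<noteq> c" "y \<noteq> k" "y \<notin> fst ` set A" "\<And>k W. (k, W) \<in> set A \<Longrightarrow> y \<notin> fv_val W"
    "y \<notin> \<tau> ` fv_decl (lets L (Tm N))" "y \<notin> \<tau> ` fv_decl (lets L (Tm (plugC Cs N)))" by auto
  obtain V' where V': "cps_repv V' \<tau> V" using ex_rep(1)[of V \<tau>] Cons.prems(2) xV by auto
  obtain T1 where T1: "cps_rep T1 (\<tau>(x := y)) (lets L (Tm N)) k"
    using ex_rep(2)[of "lets L (Tm N)" "\<tau>(x := y)" k] Cons.prems(2) xV by auto
  have x: "x \<notin> fv_frames Cs" using Cons.prems(6) xV by auto
  have im: "(\<tau>(x := y)) ` fv_frames Cs = \<tau> ` fv_frames Cs"
    using x by (intro image_cong) auto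
  have "\<exists>T'. cps_rep T' (\<tau>(x := y)) (lets L (Tm (plugC Cs N))) c \<and> eqv_decl True (lets A T1) T'"
  proof (rule Cons.IH[OF _ _ _ _ _ _ T1])
    show "chain (\<tau>(x := y)) A Cs c k" by (rule chain_cong[OF Cons.prems(1)]) (use x in auto)
    have "(\<tau>(x := y)) ` fv_decl (lets L (Tm N)) \<subseteq> insert y (\<tau> ` (fv_decl (lets L (Tm N)) - {x}))" by auto
    then show "fst ` set A \<inter> insert c ((\<tau>(x := y)) ` fv_decl (lets L (Tm N)) \<union> (\<tau>(x := y)) ` fv_frames Cs) = {}"
      unfolding im using y(3) Cons.prems(5) unfolding xV lets_simps fv_decl.simps by blast
  qed (use Cons.prems xV in auto)
  then obtain T1' where T1': "cps_rep T1' (\<tau>(x := y)) (lets L (Tm (plugC Cs N))) c" "eqv_decl True (lets A T1) T1'"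
    by blast
  have 1: "cps_rep (Let y V' T1) \<tau> (lets (xV # L) (Tm N)) k"
    unfolding xV lets_simps by (rule rep_Let[OF V' T1]) (use y in auto)
  have 2: "cps_rep (Let y V' T1') \<tau> (lets (xV # L) (Tm (plugC Cs N))) c"
    unfolding xV lets_simps by (rule rep_Let[OF V' T1'(1)]) (use y in auto)
  \<comment> \<open>\<open>T\<close> is an arbitrary representative and need not start with a
    \<open>let\<close>; it is exchanged for one that does.\<close>
  have 3: "eqv_decl True (lets A T) (lets A (Let y V' T1))"
    by (rule eqv_lets[OF rep_unique(2)[OF Cons.prems(7) 1] chain_wf[OF Cons.prems(1)]])
  have 4: "eqv_decl True (lets A (Let y V' T1)) (Let y V' (lets A T1))"
  proof (rule swap_lets)
    have "fst ` set A \<inter> \<tau> ` fv_val V = {}" using Cons.prems(5) unfolding xV lets_simps fv_decl.simps by blast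
    then have disj: "fst ` set A \<inter> fv_val V' = {}" using repv_fv[OF V'] by blast
    show "\<forall>(k, W)\<in>set A. wf_val True W \<and> y \<notin> fv_val W \<and> k \<noteq> y \<and> k \<notin> fv_val V'"
    proof
      fix p assume p: "p \<in> set A"
      obtain k W where kW: "p = (k, W)" by force
      have "k \<in> fst ` set A" using p kW by force
      moreover have "wf_val True W" using chain_wf[OF Cons.prems(1)] p kW by auto
      ultimately show "case p of (k, W) \<Rightarrow> wf_val True W \<and> y \<notin> fv_val W \<and> k \<noteq> y \<and> k \<notin> fv_val V'"
        using y(3) y(4)[of k W] disj p kW by blast
    qed
  qed (use rep_wf(1)[OF V'] rep_wf(2)[OF T1] in auto)
  have 5: "eqv_decl True (Let y V' (lets A T1)) (Let y V' T1')"
    by (rule let_cong[OF refl_v[OF rep_wf(1)[OF V']] T1'(2)])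
  from trans_d[OF trans_d[OF 3 4] 5] show ?case using 2 by blast
qed

section \<open>Reduction modulo structural congruence\<close>

lemma red_eqv: "red ak D D' \<Longrightarrow> eqv_decl ak D' D'' \<Longrightarrow> red ak D D''"
  by (meson cong red_wf refl_d)

lemma eqv_red: "eqv_decl ak D D' \<Longrightarrow> red ak D' D'' \<Longrightarrow> red ak D D''"
  by (meson cong red_wf refl_d)

lemma reds_eqv: "(red ak)\<^sup>+\<^sup>+ D D' \<Longrightarrow> eqv_decl ak D' D'' \<Longrightarrow> (red ak)\<^sup>+\<^sup>+ D D''"
  by (erule tranclp.cases) (auto intro: red_eqv tranclp.intros)

lemma eqv_reds: "eqv_decl ak D D' \<Longrightarrow> (red ak)\<^sup>+\<^sup>+ D' D'' \<Longrightarrow> (red ak)\<^sup>+\<^sup>+ D D''"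
  by (drule tranclpD) (auto intro: eqv_red rtranclp_into_tranclp2)

lemma bnd_subst [simp]:
  "bnd_val (subst_val \<sigma> V) = bnd_val V" "bnd_decl (subst_decl \<sigma> D) = bnd_decl D"
  by (induction V and D arbitrary: \<sigma> and \<sigma> rule: val.induct decl.induct) auto

lemma dlets_subset_bnd: "fst ` set (dlets D) \<subseteq> set (bnd_decl D)"
  by (induction D rule: decl.induct[of "\<lambda>_. True"]) auto

section \<open>Simulation\<close>

text \<open>A procedure body that returns a variable costs a second step, which passes the variable to the
  continuation \<open>kn\<close> of the innermost frame; that continuation is then garbage.\<close>
lemma return_step:
  assumes B: "frame_rep y B \<tau> f k"
    and P: "P \<noteq> []" "\<forall>(x, V)\<in>set P. wf_val True V" "distinct (map fst P)" "kn \<notin> fst ` set P"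
    and wf: "wf_decl False (lets L (Tm (plugF f (Var w))))"
    and T: "cps_rep T \<tau> (lets L (Tm (Var w))) kn"
    and disj: "insert kn (fst ` set P) \<inter> fv_decl (lets P (Let kn (Lam [y] B) T)) = {}"
    and kn: "kn \<notin> insert k (\<tau> ` fv_decl (lets L (Tm (plugF f (Var w)))))"
    and L: "fst ` set L \<inter> fv_frame f = {}"
  shows "\<exists>T'. cps_rep T' \<tau> (lets L (Tm (plugF f (Var w)))) k
    \<and> red True (lets P (Let kn (Lam [y] B) T)) (lets P T')"
proof -
  let ?N = "plugF f (Var w)"
  let ?X = "lets P (Let kn (Lam [y] B) T)"
  obtain xs Ms where f: "f = (xs, Ms)" by force
  have yk: "y \<noteq> k" "\<And>v. v \<in> fv_frame f \<Longrightarrow> \<tau> v \<noteq> y" and wfB: "wf_decl True B"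
    using B by (auto simp: frame_rep_def)
  let ?S = "insert kn (insert k (fst ` set P \<union> fv_decl ?X
    \<union> \<tau> ` fv_decl (lets L (Tm (Var w))) \<union> \<tau> ` fv_decl (lets L (Tm ?N))))"
  have finS: "finite ?S" by (simp del: fv_decl.simps)
  have wfL: "\<forall>(x, V)\<in>set L. wf_val False V" using wf by simp
  obtain A \<tau>' where A: "spine \<tau> A L \<tau>'" "distinct (map fst A)" and "fst ` set A \<inter> ?S = {}"
    using ex_spine[OF wfL finS, of \<tau>] by (elim exE conjE)
  then have fresh: "kn \<notin> fst ` set A" "k \<notin> fst ` set A" "fst ` set A \<inter> fst ` set P = {}"
    "fst ` set A \<inter> fv_decl ?X = {}" "fst ` set A \<inter> \<tau> ` fv_decl (lets L (Tm (Var w))) = {}"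
    "fst ` set A \<inter> \<tau> ` fv_decl (lets L (Tm ?N)) = {}" by blast+
  \<comment> \<open>\<open>T\<close> is exchanged for a representative whose prefix is spelled out,
    so that the call of \<open>kn\<close> with \<open>\<tau>' w\<close> becomes visible.\<close>
  let ?T0 = "lets A (Tm (App (Var kn) (map Var [\<tau>' w])))"
  have "cps_rep (cps_tm (subst_tm \<tau>' (Var w)) kn) \<tau>' (Tm (Var w)) kn" by (rule rep_Tm) simp
  then have "cps_rep (Tm (App (Var kn) (map Var [\<tau>' w]))) \<tau>' (Tm (Var w)) kn" by simp
  then have T0: "cps_rep ?T0 \<tau> (lets L (Tm (Var w))) kn"
    by (rule spine_rep[OF A(1) _ A(2)]) (use fresh in auto)
  obtain T2 where T2: "cps_rep T2 \<tau>' (Tm ?N) k" using ex_rep(2)[of "Tm ?N" \<tau>' k] wf by auto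
  have T3: "cps_rep (lets A T2) \<tau> (lets L (Tm ?N)) k"
    by (rule spine_rep[OF A(1) T2 A(2)]) (use fresh in blast)
  have 1: "eqv_decl True ?X (lets P (Let kn (Lam [y] B) ?T0))"
  proof -
    have "eqv_decl True (lets (P @ [(kn, Lam [y] B)]) T) (lets (P @ [(kn, Lam [y] B)]) ?T0)"
      by (rule eqv_lets[OF rep_unique(2)[OF T T0]]) (use P wfB in auto)
    then show ?thesis by simp
  qed
  have "fv_decl (lets (P @ [(kn, Lam [y] B)]) ?T0)
    \<subseteq> fv_decl (lets (P @ [(kn, Lam [y] B)]) T) \<union> (fv_decl ?T0 - fst ` set (P @ [(kn, Lam [y] B)]))"
    by (rule lets_mono)
  then have fv0: "fv_decl (lets P (Let kn (Lam [y] B) ?T0))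
      \<subseteq> fv_decl ?X \<union> (\<tau> ` fv_decl (lets L (Tm (Var w))) - insert kn (fst ` set P))"
    using rep_fv[OF T0] by (auto simp del: fv_decl.simps)
  have 2: "red True (lets P (Let kn (Lam [y] B) ?T0)) (lets P (Let kn (Lam [y] B) (lets A T2)))"
  proof (rule red_beta_general)
    show "wf_decl True (lets P (Let kn (Lam [y] B) ?T0))" using eqv_wf(2)[OF 1] by blast
    show "distinct (map fst P @ kn # map fst A)" using P A fresh by auto
    show "(fst ` set P \<union> {kn} \<union> fst ` set A) \<inter> fv_decl (lets P (Let kn (Lam [y] B) ?T0)) = {}"
      using fv0 disj fresh(4,5) by blast
    show "wf_decl True T2" using rep_wf(2)[OF T2] .
    fix q and \<rho> :: "var \<Rightarrow> var"
    let ?\<rho> = "\<rho> \<circ> updl id [y] [\<tau>' w]"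
    \<comment> \<open>The names bound by \<open>L\<close> do not occur in the frame, so the frame is
      renamed below \<open>L\<close> as it is above.\<close>
    have eq: "\<tau>' v = \<tau> v" if "v \<in> fv_frame f" for v
      using spine_notin[OF A(1), of v] that L by blast
    have fr: "?\<rho> (\<tau> v) = \<rho> (\<tau>' v)" if "v \<in> fv_frame f" for v
      using yk(2)[OF that] eq[OF that] by simp
    have xs: "map (?\<rho> \<circ> \<tau>) xs = map (\<rho> \<circ> \<tau>') xs"
      using fr unfolding f by (auto simp: fv_frame.simps)
    have Ms: "map (subst_tm (?\<rho> \<circ> \<tau>)) Ms = map (subst_tm (\<rho> \<circ> \<tau>')) Ms"
    proof (rule map_cong[OF refl], rule subst_tm_cong)
      fix M v assume "M \<in> set Ms" "v \<in> fv_tm M"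
      then have "v \<in> fv_frame f" using f by (auto simp: fv_frame.simps)
      then show "(?\<rho> \<circ> \<tau>) v = (\<rho> \<circ> \<tau>') v" using fr unfolding comp_apply by blast
    qed
    \<comment> \<open>A variable in the hole joins the processed ones, so the frame filled with
      \<open>w\<close> translates to the continuation body \<open>B\<close> with
      \<open>\<tau>' w\<close> for \<open>y\<close>.\<close>
    have "canon_decl q \<rho> T2 = ccps_decl q (\<rho> \<circ> \<tau>') (Tm ?N) (\<rho> k)" using T2 unfolding cps_rep_def by blast
    also have "\<dots> = ccps_list q (map (\<rho> \<circ> \<tau>') xs @ [\<rho> (\<tau>' w)]) (map (subst_tm (\<rho> \<circ> \<tau>')) Ms) (\<rho> k)"
      unfolding f ccps_decl.simps subst_plugF ccps_tm_plugF by simp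
    also have "\<dots> = ccps_list q (map (?\<rho> \<circ> \<tau>) xs @ [?\<rho> y]) (map (subst_tm (?\<rho> \<circ> \<tau>)) Ms) (?\<rho> k)"
      unfolding xs Ms using yk(1) by simp
    also have "\<dots> = canon_decl q ?\<rho> B"
      using B unfolding frame_rep_def f fst_conv snd_conv by metis
    finally show "canon_decl q \<rho> T2 = canon_decl q ?\<rho> B" .
  qed (use P in auto)
  have 3: "eqv_decl True (lets P (Let kn (Lam [y] B) (lets A T2))) (lets P (lets A T2))"
  proof (rule eqv_lets[OF gc P(2)])
    show "wf_decl True (Let kn (Lam [y] B) (lets A T2))" using rep_wf(2)[OF T3] wfB by simp
    \<comment> \<open>The new representative returns to \<open>k\<close>, so \<open>kn\<close> could
      only be free in it as the image of a source variable, which is excluded.\<close>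
    show "kn \<notin> fv_decl (lets A T2)" using rep_fv[OF T3] kn by blast
  qed
  show ?thesis using T3 cong[OF 1 2 3] by blast
qed

text \<open>Redex and contractum are translated under one target prefix \<open>P\<close> for
  \<open>Es\<close>, the procedure and \<open>Es'\<close>; only what lies below \<open>P\<close>
  differs. The Barendregt convention makes the source substitution and the moving of
  \<open>let\<close>s capture-free.\<close>

lemma beta_sim:
  assumes Es: "Es \<noteq> []" and len: "length zs = length ys"
    and LHS: "LHS = lets Es (Let x (Lam ys D0) (lets Es' (Tm (plugC Cs (App (Var x) (map Var zs))))))"
    and Ds: "Ds = subst_decl (mk_sub ys zs) D0"
    and RHS: "RHS = lets Es (Let x (Lam ys D0) (lets Es' (lets (dlets Ds) (Tm (plugC Cs (dbody Ds))))))"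
    and bar: "barendregt LHS" and wfL: "wf_decl False LHS" and wfR: "wf_decl False RHS"
  shows "\<exists>T T'. cps_rep T \<sigma> LHS c \<and> cps_rep T' \<sigma> RHS c \<and> (red True)\<^sup>+\<^sup>+ T T'"
proof -
  define N0 where "N0 = App (Var x) (map Var zs)"
  define DL where "DL = Tm (plugC Cs N0)"
  define DR where "DR = lets (dlets Ds) (Tm (plugC Cs (dbody Ds)))"
  have LHS': "LHS = lets Es (Let x (Lam ys D0) (lets Es' DL))" by (simp add: LHS DL_def N0_def)
  have RHS': "RHS = lets Es (Let x (Lam ys D0) (lets Es' DR))" by (simp add: RHS DR_def)
  have wfs: "\<forall>(x, V)\<in>set Es. wf_val False V" "\<forall>(x, V)\<in>set Es'. wf_val False V" "wf_decl False D0"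
    "ys \<noteq> []" "distinct ys" "wf_decl False DL" "wf_decl False DR" "wf_decl False Ds"
    using wfL wfR wf_subst(2)[of False D0] unfolding LHS' RHS' Ds by auto
  have wfC: "\<forall>(xs, Ms)\<in>set Cs. \<forall>M\<in>set Ms. wf_tm M" using wfs(6) wf_plugC unfolding DL_def by auto

  have bnd: "bnd_decl LHS = bnd_lets Es @ ys @ bnd_decl D0 @ x # bnd_lets Es'"
    by (simp add: LHS' bnd_decl_lets DL_def)
  have dist: "distinct (bnd_lets Es @ ys @ bnd_decl D0 @ x # bnd_lets Es')"
    and free: "set (bnd_lets Es @ ys @ bnd_decl D0 @ x # bnd_lets Es') \<inter> fv_decl LHS = {}"
    using bar unfolding barendregt_def bnd by blast+
  have xEs': "x \<notin> fst ` set Es'" using dist fst_subset_bnd_lets[of Es'] by auto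
  have fvLam: "fv_decl (Let x (Lam ys D0) (lets Es' DL)) \<subseteq> fv_decl LHS \<union> fst ` set Es"
    using fv_lets_subset[of "Let x (Lam ys D0) (lets Es' DL)" Es] unfolding LHS' by blast
  have fvP: "fv_decl DL \<subseteq> fv_decl LHS \<union> fst ` set Es \<union> {x} \<union> fst ` set Es'"
    using fvLam fv_lets_subset[of DL Es'] unfolding fv_decl.simps(1) by blast
  have D0P: "set (bnd_decl D0) \<inter> fv_decl DL = {}"
  proof -
    have "set (bnd_decl D0) \<inter> (set (bnd_lets Es) \<union> {x} \<union> set (bnd_lets Es')) = {}" using dist by auto
    moreover have "set (bnd_decl D0) \<inter> fv_decl LHS = {}" using free by auto
    ultimately show ?thesis using fvP fst_subset_bnd_lets[of Es] fst_subset_bnd_lets[of Es'] by blast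
  qed
  \<comment> \<open>The procedure is not recursive and \<open>Es'\<close> does not rebind its free
    variables, so these have the same renaming where it is defined and where it is called.\<close>
  have D0free: "v \<noteq> x \<and> v \<notin> fst ` set Es'" if "v \<in> fv_decl D0" "v \<notin> set ys" for v
  proof -
    have v: "v \<in> fv_decl LHS \<union> fst ` set Es" using that fvLam by auto
    have "insert x (set (bnd_lets Es')) \<inter> set (bnd_lets Es) = {}" using dist by auto
    moreover have "insert x (set (bnd_lets Es')) \<inter> fv_decl LHS = {}" using free by auto
    ultimately show ?thesis using v fst_subset_bnd_lets[of Es] fst_subset_bnd_lets[of Es'] by blast
  qed
  have zsP: "set zs \<subseteq> fv_decl DL" unfolding DL_def N0_def by auto
  have nocap: "nocap (mk_sub ys zs) (fv_decl D0) (bnd_decl D0)"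
    unfolding nocap_def
  proof
    fix v
    show "mk_sub ys zs v = v \<or> mk_sub ys zs v \<notin> set (bnd_decl D0)"
      using updl_in[of v ys zs id] updl_notin[of v ys id zs] len zsP D0P unfolding mk_sub_updl by auto
  qed
  have framesDL: "fv_frames Cs \<subseteq> fv_decl DL" unfolding DL_def by simp
  \<comment> \<open>The \<open>let\<close>s of the body can be moved over the frames: their names
    are binders of \<open>D0\<close>, which avoid everything free at the redex.\<close>
  have dl: "fst ` set (dlets Ds) \<inter> fv_frames Cs = {}"
    using dlets_subset_bnd[of Ds] D0P framesDL unfolding Ds bnd_subst by blast

  \<comment> \<open>Each \<open>S\<close> collects names to be avoided by later choices;
    \<open>\<sigma>1\<close>, \<open>\<sigma>x\<close> and \<open>\<tau>\<close> are the renamings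
    below \<open>Es\<close>, the procedure and \<open>Es'\<close>.\<close>
  define S0 where "S0 = insert c (\<sigma> ` (fv_decl LHS \<union> fv_decl RHS))"
  have finS0: "finite S0" by (simp add: S0_def)
  from ex_spine[OF wfs(1) finS0, of \<sigma>] obtain A1 \<sigma>1 where A1: "spine \<sigma> A1 Es \<sigma>1" "distinct (map fst A1)" "fst ` set A1 \<inter> S0 = {}"
    by (elim exE conjE)
  define S1 where "S1 = S0 \<union> fst ` set A1 \<union> \<sigma>1 ` (fv_decl (lets Es' DL) \<union> fv_decl (lets Es' DR) \<union> fv_decl D0)"
  have finS1: "finite S1" using finS0 by (simp add: S1_def)
  from ex_fresh_var[OF this] obtain x' where x': "x' \<notin> S1" by (elim exE)
  have D0rep: "\<And>\<sigma> c. \<exists>T. cps_rep T \<sigma> D0 c" by (rule ex_rep(2)[OF wfs(3)])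
  obtain ys' k0 T0 where Lam: "cps_repv (Lam (ys' @ [k0]) T0) \<sigma>1 (Lam ys D0)" and T0: "cps_rep T0 (updl \<sigma>1 ys ys') D0 k0"
    and ys': "length ys' = length ys" "distinct (ys' @ [k0])" "set (ys' @ [k0]) \<inter> S1 = {}"
    using ex_rep_Lam[OF D0rep finS1 wfs(4), of \<sigma>1] by (elim exE conjE)
  define W where "W = Lam (ys' @ [k0]) T0"
  define \<sigma>x where "\<sigma>x = \<sigma>1(x := x')"
  define S2 where "S2 = insert x' (S1 \<union> \<sigma>x ` (fv_decl (lets Es' DL) \<union> fv_decl (lets Es' DR)))"
  have finS2: "finite S2" using finS1 by (simp add: S2_def)
  from ex_spine[OF wfs(2) finS2, of \<sigma>x] obtain A2 \<tau> where A2: "spine \<sigma>x A2 Es' \<tau>" "distinct (map fst A2)" "fst ` set A2 \<inter> S2 = {}"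
    by (elim exE conjE)
  define S3 where "S3 = S2 \<union> fst ` set A2 \<union> \<tau> ` (fv_decl DL \<union> fv_decl DR)"
  have finS3: "finite S3" using finS2 by (simp add: S3_def)
  from ex_chain[OF wfC finS3, where c = c and \<tau> = \<tau>] obtain A3 kn where A3: "chain \<tau> A3 Cs c kn" "distinct (map fst A3)" "fst ` set A3 \<inter> S3 = {}"
    by (elim exE conjE)
  have S: "S0 \<subseteq> S1" "S1 \<subseteq> S2" "S2 \<subseteq> S3" "fst ` set A1 \<subseteq> S1" "x' \<in> S2" "fst ` set A2 \<subseteq> S3"
    "\<tau> ` fv_decl DL \<subseteq> S3" "\<tau> ` fv_decl DR \<subseteq> S3" "c \<in> S1" "\<sigma>1 ` fv_decl D0 \<subseteq> S1"
    unfolding S0_def S1_def S2_def S3_def by auto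
  have S': "S1 \<subseteq> S3" "fst ` set A1 \<subseteq> S2" "fst ` set A1 \<subseteq> S3" "x' \<in> S3" "c \<in> S2" "c \<in> S3"
    unfolding S0_def S1_def S2_def S3_def by auto
  have W: "cps_repv W \<sigma>1 (Lam ys D0)" unfolding W_def by (rule Lam)
  define P where "P = A1 @ (x', W) # A2"
  have wfP: "\<forall>(x, V)\<in>set P. wf_val True V"
    using spine_wf[OF A1(1)] spine_wf[OF A2(1)] rep_wf(1)[OF W] by (auto simp: P_def)
  have P: "P \<noteq> []" by (simp add: P_def)
  have A1ne: "A1 \<noteq> []" using spine_length[OF A1(1)] Es by auto
  have "fst ` set P = fst ` set A1 \<union> {x'} \<union> fst ` set A2" by (auto simp: P_def)
  then have namesP: "fst ` set P \<subseteq> S3" using S(6) S'(3,4) by simp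
  have distPA: "distinct (map fst (P @ A3))"
  proof -
    have "x' \<notin> fst ` set A1" "x' \<notin> fst ` set A2" "fst ` set A1 \<inter> fst ` set A2 = {}"
      using x' S(4,5) S'(2) A2(3) by blast+
    then have "distinct (map fst P)" using A1(2) A2(2) unfolding P_def by auto
    moreover have "fst ` set P \<inter> fst ` set A3 = {}" using namesP A3(3) by blast
    ultimately show ?thesis using A3(2) by auto
  qed
  have up: "cps_rep (lets P T) \<sigma> (lets Es (Let x (Lam ys D0) (lets Es' D))) c"
    if T: "cps_rep T \<tau> D c" and D: "D = DL \<or> D = DR" for T D
  proof -
    have D1: "\<sigma>x ` fv_decl (lets Es' D) \<subseteq> S2" "\<sigma>1 ` fv_decl (lets Es' D) \<subseteq> S1"
      using D unfolding S1_def S2_def by auto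
    have D2: "\<sigma> ` fv_decl (lets Es (Let x (Lam ys D0) (lets Es' D))) \<subseteq> S0"
      using D unfolding S0_def LHS' RHS' by auto
    have 1: "cps_rep (lets A2 T) \<sigma>x (lets Es' D) c"
      by (rule spine_rep[OF A2(1) T A2(2)]) (use D1(1) A2(3) S'(5) in blast)
    have 2: "cps_rep (Let x' W (lets A2 T)) \<sigma>1 (Let x (Lam ys D0) (lets Es' D)) c"
    proof (rule rep_Let[OF W])
      show "cps_rep (lets A2 T) (\<sigma>1(x := x')) (lets Es' D) c" using 1 unfolding \<sigma>x_def .
      show "x' \<notin> \<sigma>1 ` (fv_decl (lets Es' D) - {x})" "x' \<noteq> c" using x' D1(2) S(9) by blast+
    qed
    have "cps_rep (lets A1 (Let x' W (lets A2 T))) \<sigma> (lets Es (Let x (Lam ys D0) (lets Es' D))) c"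
      by (rule spine_rep[OF A1(1) 2 A1(2)]) (use D2 A1(3) in \<open>auto simp: S0_def\<close>)
    then show ?thesis by (simp add: P_def)
  qed

  have \<tau>x: "\<tau> x = x'" using spine_notin[OF A2(1) xEs'] by (simp add: \<sigma>x_def)
  define zs' where "zs' = map \<tau> zs @ [kn]"
  define b where "b = Tm (App (Var x') (map Var zs'))"
  have "cps_rep (cps_tm (subst_tm \<tau> N0) kn) \<tau> (Tm N0) kn"
    by (rule rep_Tm) (use wfs(6) wf_plugC[of Cs N0] in \<open>auto simp: DL_def\<close>)
  moreover have "cps_tm (subst_tm \<tau> N0) kn = b"
    using cps_list_Vars[of "[x']" "map \<tau> zs" "[]" kn] by (simp add: N0_def b_def zs'_def \<tau>x comp_def)
  ultimately have b: "cps_rep b \<tau> (Tm N0) kn" by simp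
  have "cps_rep (lets A3 b) \<tau> (Tm (plugC Cs N0)) c"
  proof (rule chain_rep[OF A3(1) b])
    show "Cs = [] \<or> is_App N0" by (simp add: N0_def is_App_def)
    show "fst ` set A3 \<inter> insert c (\<tau> ` fv_tm (plugC Cs N0)) = {}"
      using A3(3) S(7) S'(6) unfolding DL_def fv_decl.simps by blast
  qed (rule A3(2))
  then have T: "cps_rep (lets P (lets A3 b)) \<sigma> LHS c" using up[of "lets A3 b" DL] unfolding LHS' DL_def by blast

  have dj: "A \<inter> X = {} \<Longrightarrow> Y \<subseteq> X \<Longrightarrow> A \<inter> Y = {}" for A X Y :: "var set" by blast
  have disjPA: "fst ` set (P @ A3) \<inter> fv_decl (lets (P @ A3) b) = {}"
  proof (rule dj)
    have "S0 \<subseteq> S2" "S0 \<subseteq> S3" using subset_trans[OF S(1,2)] subset_trans[OF S(1) S'(1)] by simp_all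
    then have "fst ` set A2 \<inter> S0 = {}" "fst ` set A3 \<inter> S0 = {}"
      using dj[OF A2(3)] dj[OF A3(3)] by (simp_all only:)
    moreover have "x' \<notin> S0" using x' subsetD[OF S(1)] by metis
    moreover have "fst ` set (P @ A3) = fst ` set A1 \<union> {x'} \<union> fst ` set A2 \<union> fst ` set A3"
      by (auto simp: P_def)
    ultimately show "fst ` set (P @ A3) \<inter> S0 = {}" using A1(3) by (simp add: Int_Un_distrib2)
    show "fv_decl (lets (P @ A3) b) \<subseteq> S0" using rep_fv[OF T] by (auto simp: S0_def)
  qed

  \<comment> \<open>The call passes \<open>kn\<close> for \<open>k0\<close>, so the body continues
    with the innermost continuation. Any representative \<open>T1\<close> will do, since
    \<open>red_beta_general\<close> constrains the contractum only through its canonical forms and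
    well-formedness.\<close>
  have step1: "red True (lets (P @ A3) b) (lets (P @ A3) T1)" if T1: "cps_rep T1 \<tau> Ds kn" for T1
  proof -
    have "red True (lets A1 (Let x' (Lam (ys' @ [k0]) T0) (lets (A2 @ A3) (Tm (App (Var x') (map Var zs'))))))
      (lets A1 (Let x' (Lam (ys' @ [k0]) T0) (lets (A2 @ A3) T1)))"
    proof (rule red_beta_general[OF _ A1ne])
      show "wf_decl True (lets A1 (Let x' (Lam (ys' @ [k0]) T0) (lets (A2 @ A3) (Tm (App (Var x') (map Var zs'))))))"
        using rep_wf(2)[OF T] by (simp add: P_def W_def b_def)
      show "length zs' = length (ys' @ [k0])" using ys'(1) len by (simp add: zs'_def)
      show "distinct (map fst A1 @ x' # map fst (A2 @ A3))" using distPA by (simp add: P_def)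
      show "(fst ` set A1 \<union> {x'} \<union> fst ` set (A2 @ A3)) \<inter>
        fv_decl (lets A1 (Let x' (Lam (ys' @ [k0]) T0) (lets (A2 @ A3) (Tm (App (Var x') (map Var zs')))))) = {}"
        using disjPA unfolding P_def W_def b_def by (simp del: fv_decl.simps fv_val.simps add: image_Un)
      show "wf_decl True T1" by (rule rep_wf(2)[OF T1])
      fix q and \<rho> :: "var \<Rightarrow> var"
      let ?U = "updl (id(k0 := kn)) ys' (map \<tau> zs)"
      have U: "updl id (ys' @ [k0]) zs' = ?U" unfolding zs'_def using ys'(1) len by (simp add: updl_append)
      have Uk: "?U k0 = kn" using ys'(2) by (simp add: updl_notin)
      have "cps_rep T1 (\<tau> \<circ> mk_sub ys zs) D0 kn" using T1 rep_subst[OF nocap] unfolding Ds by blast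
      then have "canon_decl q \<rho> T1 = ccps_decl q (\<rho> \<circ> (\<tau> \<circ> mk_sub ys zs)) D0 (\<rho> kn)" unfolding cps_rep_def by blast
      also have "\<dots> = ccps_decl q ((\<rho> \<circ> ?U) \<circ> updl \<sigma>1 ys ys') D0 (\<rho> kn)"
      proof (rule ccps_cong)
        fix v assume v: "v \<in> fv_decl D0"
        then have \<sigma>v: "\<sigma>1 v \<in> S1" using S(10) by blast
        have "?U (updl \<sigma>1 ys ys' v) = updl (id(k0 := kn) \<circ> \<sigma>1) ys (map \<tau> zs) v"
          by (rule updl_updl) (use ys' len \<sigma>v in auto)
        also have "\<dots> = updl (\<tau> \<circ> id) ys (map \<tau> zs) v"
        proof (rule updl_cong)
          assume "v \<notin> set ys"
          then have "v \<noteq> x" "v \<notin> fst ` set Es'" using D0free v by blast+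
          then have "\<tau> v = \<sigma>1 v" using spine_notin[OF A2(1)] by (simp add: \<sigma>x_def)
          moreover have "\<sigma>1 v \<noteq> k0" using \<sigma>v ys'(3) by auto
          ultimately show "(id(k0 := kn) \<circ> \<sigma>1) v = (\<tau> \<circ> id) v" by simp
        qed (use len in simp)
        also have "\<dots> = \<tau> (mk_sub ys zs v)" unfolding mk_sub_updl by (rule updl_apply[symmetric])
        finally show "(\<rho> \<circ> (\<tau> \<circ> mk_sub ys zs)) v = ((\<rho> \<circ> ?U) \<circ> updl \<sigma>1 ys ys') v" by simp
      qed
      also have "\<dots> = ccps_decl q ((\<rho> \<circ> ?U) \<circ> updl \<sigma>1 ys ys') D0 ((\<rho> \<circ> ?U) k0)" by (simp only: comp_apply Uk)
      also have "\<dots> = canon_decl q (\<rho> \<circ> ?U) T0" using T0 unfolding cps_rep_def by metis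
      finally show "canon_decl q \<rho> T1 = canon_decl q (\<rho> \<circ> updl id (ys' @ [k0]) zs') T0" unfolding U .
    qed
    then show ?thesis by (simp add: P_def W_def b_def)
  qed

  have fvDs: "fv_decl Ds \<subseteq> fv_decl DR" if "dbody Ds = N" for N
  proof -
    have "fv_decl (lets (dlets Ds) (Tm N)) \<subseteq> fv_decl (lets (dlets Ds) (Tm (plugC Cs N)))"
      using lets_mono[of "dlets Ds" "Tm N" "Tm (plugC Cs N)"] fv_lets_subset[of "Tm (plugC Cs N)" "dlets Ds"]
      by auto
    then show ?thesis using lets_dlets[of Ds] that unfolding DR_def by simp
  qed

  show ?thesis
  proof (cases "Cs = [] \<or> is_App (dbody Ds)")
    \<comment> \<open>Without frames \<open>kn\<close> is \<open>c\<close>, and a returned variable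
      already yields its translation; if the body ends in an application, only the
      \<open>let\<close>s have to be commuted. Either way one step suffices.\<close>
    case True
    obtain T1 where T1: "cps_rep T1 \<tau> Ds kn" using ex_rep(2)[OF wfs(8)] by blast
    have "\<exists>T'. cps_rep T' \<tau> (lets (dlets Ds) (Tm (plugC Cs (dbody Ds)))) c \<and> eqv_decl True (lets A3 T1) T'"
    proof (rule chain_comm[OF A3(1) _ True A3(2) _ dl])
      show "fst ` set A3 \<inter> insert c (\<tau> ` fv_decl (lets (dlets Ds) (Tm (dbody Ds))) \<union> \<tau> ` fv_frames Cs) = {}"
        unfolding lets_dlets using fvDs[OF refl] A3(3) S(7,8) S'(6) framesDL by blast
    qed (use T1 wfs(8) in simp_all)
    then obtain T2 where T2: "cps_rep T2 \<tau> DR c" "eqv_decl True (lets A3 T1) T2" unfolding DR_def by blast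
    have "eqv_decl True (lets P (lets A3 T1)) (lets P T2)" by (rule eqv_lets[OF T2(2) wfP])
    then have "red True (lets P (lets A3 b)) (lets P T2)" using step1[OF T1] red_eqv by simp
    moreover have "cps_rep (lets P T2) \<sigma> RHS c" using up[OF T2(1)] unfolding RHS' by blast
    ultimately show ?thesis using T by blast
  next
    case False
    then obtain w where w: "dbody Ds = Var w" by (cases "dbody Ds") (auto simp: is_App_def)
    \<comment> \<open>The innermost frame is split off because its continuation \<open>kn\<close> is
      the one called next.\<close>
    obtain Cs' f where Cs: "Cs = Cs' @ [f]" using False by (metis rev_exhaust)
    obtain A' k y B where A': "A3 = A' @ [(kn, Lam [y] B)]" "chain \<tau> A' Cs' c k" "frame_rep y B \<tau> f k"
      using A3(1) unfolding Cs by (cases rule: chain.cases) auto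
    let ?L = "dlets Ds" and ?N = "plugF f (Var w)"
    have DR: "DR = lets ?L (Tm (plugC Cs' ?N))" by (simp add: DR_def Cs plugC_append w)
    have Ds': "Ds = lets ?L (Tm (Var w))" using lets_dlets[of Ds] w by simp
    have wfN: "wf_decl False (lets ?L (Tm ?N))"
      using wfs(7) wf_plugC[of Cs' ?N] unfolding DR by simp
    have fvN: "fv_decl (lets ?L (Tm ?N)) \<subseteq> fv_decl DR"
      using lets_mono[of ?L "Tm ?N" "Tm (plugC Cs' ?N)"] fv_lets_subset[of "Tm (plugC Cs' ?N)" ?L]
      unfolding DR by auto
    obtain T1 where T1: "cps_rep T1 \<tau> Ds kn" using ex_rep(2)[OF wfs(8)] by blast
    note red1 = step1[OF T1]
    have knA': "kn \<notin> fst ` set A'" "kn \<notin> S3" "kn \<noteq> c" "distinct (map fst A')" "fst ` set A' \<subseteq> fst ` set A3"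
      using A3(2,3) S'(6) A'(1) by auto
    have "\<exists>T'. cps_rep T' \<tau> (lets ?L (Tm ?N)) k
      \<and> red True (lets (P @ A') (Let kn (Lam [y] B) T1)) (lets (P @ A') T')"
    proof (rule return_step[OF A'(3) _ _ _ _ wfN])
      show "P @ A' \<noteq> []" using P by simp
      show "\<forall>(x, V)\<in>set (P @ A'). wf_val True V" using wfP chain_wf[OF A'(2)] by auto
      show "distinct (map fst (P @ A'))" using distPA unfolding A'(1) by simp
      show "kn \<notin> fst ` set (P @ A')" using distPA unfolding A'(1) by (simp add: image_Un)
      show "cps_rep T1 \<tau> (lets ?L (Tm (Var w))) kn" using T1 Ds' by simp
      have "fv_decl (lets (P @ A3) T1) \<subseteq> fv_decl (lets (P @ A3) b) \<union> (fv_decl T1 - fst ` set (P @ A3))"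
        by (rule lets_mono)
      then have "fst ` set (P @ A3) \<inter> fv_decl (lets (P @ A3) T1) = {}" using disjPA by blast
      then show "insert kn (fst ` set (P @ A')) \<inter> fv_decl (lets (P @ A') (Let kn (Lam [y] B) T1)) = {}"
        unfolding A'(1) by (simp del: fv_decl.simps)
      have "k \<noteq> kn" using chain_last[OF A'(2)] knA' by blast
      then show "kn \<notin> insert k (\<tau> ` fv_decl (lets ?L (Tm ?N)))" using fvN knA'(2) S(8) by blast
      show "fst ` set ?L \<inter> fv_frame f = {}" using dl unfolding Cs by auto
    qed
    then obtain T3 where T3: "cps_rep T3 \<tau> (lets ?L (Tm ?N)) k"
      "red True (lets (P @ A') (Let kn (Lam [y] B) T1)) (lets (P @ A') T3)" by blast
    have "\<exists>T'. cps_rep T' \<tau> (lets ?L (Tm (plugC Cs' ?N))) c \<and> eqv_decl True (lets A' T3) T'"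
    proof (rule chain_comm[OF A'(2) wfN _ knA'(4) _ _ T3(1)])
      have "fv_frames Cs' \<subseteq> fv_decl DL" using framesDL unfolding Cs by simp
      then show "fst ` set A' \<inter> insert c (\<tau> ` fv_decl (lets ?L (Tm ?N)) \<union> \<tau> ` fv_frames Cs') = {}"
        using fvN knA'(5) A3(3) S(7,8) S'(6) by blast
      show "fst ` set ?L \<inter> fv_frames Cs' = {}" using dl unfolding Cs by auto
    qed simp
    then obtain T4 where T4: "cps_rep T4 \<tau> DR c" "eqv_decl True (lets A' T3) T4" unfolding DR by blast
    have "eqv_decl True (lets P (lets A' T3)) (lets P T4)" by (rule eqv_lets[OF T4(2) wfP])
    then have red2: "red True (lets (P @ A3) T1) (lets P T4)" using T3(2) red_eqv unfolding A'(1) by simp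
    have "cps_rep (lets P T4) \<sigma> RHS c" using up[OF T4(1)] unfolding RHS' by blast
    moreover have "(red True)\<^sup>+\<^sup>+ (lets (P @ A3) b) (lets P T4)"
      using red1 red2 by (meson tranclp.r_into_trancl tranclp.trancl_into_trancl)
    ultimately show ?thesis using T by auto
  qed
qed

text \<open>Using representatives at every intermediate declaration avoids freshness demands on the
  names that conversions introduce; neighbouring pieces are glued by
  \<open>rep_unique\<close>.\<close>

lemma red_cps:
  "red False D D' \<Longrightarrow> \<exists>T T'. cps_rep T \<sigma> D c \<and> cps_rep T' \<sigma> D' c \<and> (red True)\<^sup>+\<^sup>+ T T'"
proof (induction rule: red.induct)
  case (beta Es Es' zs ys LHS x D0 C C' Ds RHS)
  show ?case
    \<comment> \<open>The two nested term contexts act as the single context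
      \<open>C @ C'\<close>.\<close>
    by (rule beta_sim[OF beta(1,3) beta(4)[folded plugC_append] beta(5) beta(6)[folded plugC_append] beta(7-9)])
next
  case (cong D1 D1' D2' D2)
  obtain T1 T1' where 1: "cps_rep T1 \<sigma> D1 c" "cps_rep T1' \<sigma> D1' c" "eqv_decl True T1 T1'"
    using eqv_cps(2)[OF cong.hyps(1)] by blast
  obtain U1 U2 where 2: "cps_rep U1 \<sigma> D1' c" "cps_rep U2 \<sigma> D2' c" "(red True)\<^sup>+\<^sup>+ U1 U2"
    using cong.IH by blast
  obtain T2' T2 where 3: "cps_rep T2' \<sigma> D2' c" "cps_rep T2 \<sigma> D2 c" "eqv_decl True T2' T2"
    using eqv_cps(2)[OF cong.hyps(3)] by blast
  have "eqv_decl True T1 U1" by (rule trans_d[OF 1(3) rep_unique(2)[OF 1(2) 2(1)]])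
  moreover have "eqv_decl True U2 T2" by (rule trans_d[OF rep_unique(2)[OF 2(2) 3(1)] 3(3)])
  ultimately have "(red True)\<^sup>+\<^sup>+ T1 T2" using 2(3) eqv_reds reds_eqv by blast
  then show ?case using 1 3 by blast
qed

lemma red_cps_decl:
  assumes "wf_decl False D" "k \<notin> av_decl D" "red False D D'" "k \<notin> av_decl D'"
  shows "(red True)\<^sup>+\<^sup>+ (cps_decl D k) (cps_decl D' k)"
proof -
  obtain T T' where T: "cps_rep T id D k" "cps_rep T' id D' k" "(red True)\<^sup>+\<^sup>+ T T'"
    using red_cps[OF assms(3)] by blast
  have "wf_decl False D'" using red_wf[OF assms(3)] by blast
  then have "cps_rep (cps_decl D k) id D k" "cps_rep (cps_decl D' k) id D' k"
    using rep_cps(2) assms by blast+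
  then show ?thesis using T rep_unique(2) eqv_reds reds_eqv by blast
qed

section \<open>Typing\<close>

lemma map_upds_map_cong:
  "length ys = length zs \<Longrightarrow> (v \<notin> set ys \<Longrightarrow> m' v = map_option f (m v)) \<Longrightarrow>
   (m'(ys [\<mapsto>] map f zs)) v = map_option f ((m(ys [\<mapsto>] zs)) v)"
  by (induction ys zs arbitrary: m m' rule: list_induct2) auto

text \<open>\<open>Us\<close> types the variables processed so far and \<open>Us'\<close> the terms
  still to come, so their concatenation is invariant when a term moves over. Processed variables are
  typed in \<open>\<Delta>\<close> only, since \<open>\<Gamma>\<close> does not know the generated
  ones.\<close>

lemma cps_list_ty:
  "Us @ Us' = Arr As B # As \<Longrightarrow> list_all2 (\<lambda>v U. \<Delta> v = Some (psi U)) vs Us \<Longrightarrow>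
   list_all2 (ty_tm \<Gamma>) ts Us' \<Longrightarrow> \<Delta> k = Some (Kty B) \<Longrightarrow>
   (\<And>v. v \<in> \<Union> (set (map fv_tm ts)) \<Longrightarrow> \<Delta> v = map_option psi (\<Gamma> v)) \<Longrightarrow>
   ty_decl \<Delta> (cps_list vs ts k) Res"
proof (induction vs ts k arbitrary: \<Delta> Us Us' As B rule: cps_list.induct)
  case (1 k)
  then show ?case by simp
next
  case (2 x xs k)
  then have Us: "Us = Arr As B # As" by auto
  have x: "\<Delta> x = Some (psi (Arr As B))" and xs: "list_all2 (\<lambda>v U. \<Delta> v = Some (psi U)) xs As"
    using 2(2) unfolding Us by auto
  have "ty_tm \<Delta> (App (Var x) (map Var xs @ [Var k])) Res"
  proof (rule t_app)
    show "ty_tm \<Delta> (Var x) (Arr (map psi As @ [Kty B]) Res)" using x by (auto intro: t_var simp: Kty_def)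
    show "length (map Var xs @ [Var k]) = length (map psi As @ [Kty B])"
      using list_all2_lengthD[OF xs] by simp
    show "\<forall>i<length (map Var xs @ [Var k]). ty_tm \<Delta> ((map Var xs @ [Var k]) ! i) ((map psi As @ [Kty B]) ! i)"
      using list_all2_lengthD[OF xs] list_all2_nthD[OF xs] 2(4)
      by (auto simp: nth_append less_Suc_eq intro!: t_var)
  qed
  then show ?case by (auto intro: t_tm)
next
  case (3 vs x ts k)
  obtain U Us'' where U: "Us' = U # Us''" "ty_tm \<Gamma> (Var x) U" "list_all2 (ty_tm \<Gamma>) ts Us''"
    using 3(4) by (auto simp: list_all2_Cons1)
  have "\<Gamma> x = Some U" using U(2) by (cases rule: ty_tm.cases) auto
  then have vsx: "list_all2 (\<lambda>v U. \<Delta> v = Some (psi U)) (vs @ [x]) (Us @ [U])"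
    using 3(3,6) by (auto intro!: list_all2_appendI)
  have UsU: "(Us @ [U]) @ Us'' = Arr As B # As" using 3(2) U(1) by simp
  have "ty_decl \<Delta> (cps_list (vs @ [x]) ts k) Res"
    by (rule "3.IH"[OF UsU vsx]) (use U(3) 3(5,6) in auto)
  then show ?case by simp
next
  case (4 vs M Ms ts k)
  define S where "S = set vs \<union> \<Union> (set (map fv_tm ts)) \<union> {k} \<union> fv_tm (App M Ms)"
  have finS: "finite S" by (auto simp: S_def)
  define y where "y = fresh S"
  have y: "y \<notin> S" "Suc y \<notin> S" using fresh_gt[OF finS, of y] fresh_gt[OF finS, of "Suc y"] by (auto simp: y_def)
  have eq: "cps_list vs (App M Ms # ts) k = Let (Suc y) (Lam [y] (cps_list (vs @ [y]) ts k)) (cps_list [] (M # Ms) (Suc y))"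
    by (simp only: cps_list.simps Let_def y_def S_def)
  obtain U Us'' where U: "Us' = U # Us''" "ty_tm \<Gamma> (App M Ms) U" "list_all2 (ty_tm \<Gamma>) ts Us''"
    using "4.prems"(3) by (auto simp: list_all2_Cons1)
  obtain As' where As': "ty_tm \<Gamma> M (Arr As' U)" "list_all2 (ty_tm \<Gamma>) Ms As'"
    using U(2) by (cases rule: ty_tm.cases) (auto simp: list_all2_conv_all_nth)
  have 1: "ty_decl (\<Delta>(y \<mapsto> psi U)) (cps_list (vs @ [y]) ts k) Res"
  proof (rule "4.IH"(1)[OF y_def[unfolded S_def] refl])
    show "(Us @ [U]) @ Us'' = Arr As B # As" using "4.prems"(1) U(1) by simp
    have "y \<notin> set vs" using y by (simp add: S_def)
    then have "list_all2 (\<lambda>v U'. (\<Delta>(y \<mapsto> psi U)) v = Some (psi U')) vs Us"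
      using "4.prems"(2) by (auto elim!: list.rel_mono_strong)
    then show "list_all2 (\<lambda>v U'. (\<Delta>(y \<mapsto> psi U)) v = Some (psi U')) (vs @ [y]) (Us @ [U])"
      by (intro list_all2_appendI) auto
    show "(\<Delta>(y \<mapsto> psi U)) k = Some (Kty B)" using "4.prems"(4) y by (auto simp: S_def)
    show "(\<Delta>(y \<mapsto> psi U)) v = map_option psi (\<Gamma> v)" if "v \<in> \<Union> (set (map fv_tm ts))" for v
    proof -
      have "v \<noteq> y" using that y unfolding S_def by blast
      then show ?thesis using "4.prems"(5)[of v] that by simp
    qed
  qed (rule U(3))
  have 2: "ty_decl (\<Delta>(Suc y \<mapsto> Kty U)) (cps_list [] (M # Ms) (Suc y)) Res"
  proof (rule "4.IH"(2)[OF y_def[unfolded S_def] refl])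
    show "[] @ (Arr As' U # As') = Arr As' U # As'" by simp
    show "(\<Delta>(Suc y \<mapsto> Kty U)) v = map_option psi (\<Gamma> v)" if "v \<in> \<Union> (set (map fv_tm (M # Ms)))" for v
    proof -
      have "v \<noteq> Suc y" using that y unfolding S_def by auto
      then show ?thesis using "4.prems"(5)[of v] that by auto
    qed
  qed (use As' in auto)
  show ?case unfolding eq
    by (rule t_lam[of "[psi U]"]) (use 1 2 in \<open>auto simp: Kty_def\<close>)
qed

lemma cps_tm_ty:
  assumes "ty_tm \<Gamma> M A" "\<Delta> k = Some (Kty A)" "\<And>v. v \<in> fv_tm M \<Longrightarrow> \<Delta> v = map_option psi (\<Gamma> v)"
  shows "ty_decl \<Delta> (cps_tm M k) Res"
proof (cases M)
  case (Var x)
  have "\<Gamma> x = Some A" using assms(1) unfolding Var by (cases rule: ty_tm.cases) auto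
  then have "ty_tm \<Delta> (Var x) (psi A)" "ty_tm \<Delta> (Var k) (Arr [psi A] Res)"
    using assms(2,3) Var by (auto intro!: t_var simp: Kty_def)
  then show ?thesis unfolding Var by (auto intro!: t_tm t_app)
next
  case (App N Ns)
  obtain As where "ty_tm \<Gamma> N (Arr As A)" "list_all2 (ty_tm \<Gamma>) Ns As"
    using assms(1) unfolding App by (cases rule: ty_tm.cases) (auto simp: list_all2_conv_all_nth)
  then have "ty_decl \<Delta> (cps_list [] (N # Ns) k) Res"
    by (intro cps_list_ty[of "[]" "Arr As A # As" As A \<Delta> _ \<Gamma>]) (use assms App in auto)
  then show ?thesis by (simp add: App)
qed

text \<open>Inside a procedure body \<open>\<Delta>\<close> still holds the outer continuation, for
  which \<open>\<Gamma>\<close> has no counterpart; agreement on free variables takes the place of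
  weakening.\<close>

lemma cps_decl_ty:
  "ty_decl \<Gamma> D A \<Longrightarrow> k \<notin> av_decl D \<Longrightarrow> \<Delta> k = Some (Kty A) \<Longrightarrow>
   (\<And>v. v \<in> fv_decl D \<Longrightarrow> \<Delta> v = map_option psi (\<Gamma> v)) \<Longrightarrow> ty_decl \<Delta> (cps_decl D k) Res"
proof (induction arbitrary: \<Delta> k rule: ty_decl.induct)
  case (t_tm \<Gamma> M A)
  then show ?case using cps_tm_ty by simp
next
  case (t_star \<Gamma> x D A)
  have "ty_decl (\<Delta>(x \<mapsto> Unit)) (cps_decl D k) Res"
    by (rule t_star.IH) (use t_star.prems in auto)
  then show ?case by (auto intro: ty_decl.t_star)
next
  case (t_lam As ys \<Gamma> D' C x D B)
  let ?k = "fresh (set ys \<union> av_decl D')"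
  have k: "v < ?k" if "v \<in> set ys \<union> av_decl D'" for v by (rule fresh_gt) (use that in auto)
  have k': "?k \<notin> set ys" "?k \<notin> av_decl D'" using k by blast+
  have "ty_decl (\<Delta>((ys @ [?k]) [\<mapsto>] (map psi As @ [Kty C]))) (cps_decl D' ?k) Res"
  proof (rule t_lam.IH(1)[OF k'(2)])
    have eq: "\<Delta>((ys @ [?k]) [\<mapsto>] (map psi As @ [Kty C])) = (\<Delta>(ys [\<mapsto>] map psi As))(?k \<mapsto> Kty C)"
      using t_lam.hyps(1) by (simp add: nth_append)
    show "(\<Delta>((ys @ [?k]) [\<mapsto>] (map psi As @ [Kty C]))) ?k = Some (Kty C)" unfolding eq by simp
    fix v assume v: "v \<in> fv_decl D'"
    then have "v \<noteq> ?k" using k'(2) fv_subset_av(2)[of D'] by blast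
    moreover have "(\<Delta>(ys [\<mapsto>] map psi As)) v = map_option psi ((\<Gamma>(ys [\<mapsto>] As)) v)"
      by (rule map_upds_map_cong) (use t_lam.hyps t_lam.prems(3) v in auto)
    ultimately show "(\<Delta>((ys @ [?k]) [\<mapsto>] (map psi As @ [Kty C]))) v = map_option psi ((\<Gamma>(ys [\<mapsto>] As)) v)"
      unfolding eq by simp
  qed
  moreover have "ty_decl (\<Delta>(x \<mapsto> Arr (map psi As @ [Kty C]) Res)) (cps_decl D k) Res"
    by (rule t_lam.IH(2)) (use t_lam.prems in \<open>auto simp: Kty_def\<close>)
  ultimately have "ty_decl \<Delta> (Let x (Lam (ys @ [?k]) (cps_decl D' ?k)) (cps_decl D k)) Res"
    by (intro ty_decl.t_lam) (use t_lam.hyps(1) in auto)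
  then show ?case by (simp only: cps_decl.simps cps_val.simps Let_def)
qed

theorem theorem2:
  fixes \<Gamma> :: "var \<rightharpoonup> ty" and D :: decl and A :: ty and k :: var
  assumes "finite (dom \<Gamma>)"
    and "\<forall>x B. \<Gamma> x = Some B \<longrightarrow> wf_ty B"
    and "wf_decl False D"
    and "ty_decl \<Gamma> D A"
    and "k \<notin> av_decl D" and "k \<notin> dom \<Gamma>"
  shows "ty_decl ((psi_ctx \<Gamma>)(k \<mapsto> Kty A)) (cps_decl D k) Res
       \<and> (\<forall>D'. red False D D' \<and> k \<notin> av_decl D'
               \<longrightarrow> (red True)\<^sup>+\<^sup>+ (cps_decl D k) (cps_decl D' k))"
proof (intro conjI allI impI)
  show "ty_decl ((psi_ctx \<Gamma>)(k \<mapsto> Kty A)) (cps_decl D k) Res"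
    by (rule cps_decl_ty[OF assms(4,5)]) (use assms(5) fv_subset_av(2)[of D] in \<open>auto simp: psi_ctx_def\<close>)
  show "(red True)\<^sup>+\<^sup>+ (cps_decl D k) (cps_decl D' k)" if "red False D D' \<and> k \<notin> av_decl D'" for D'
    using red_cps_decl[OF assms(3,5)] that by blast
qed

end
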